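(* There is an absolute constant $\gamma$ such that every CNF $\varphi$ with $n=|Var(\varphi)|$ variables can be represented as the conjunction of two OBDDs, each having at most $2^{2\gamma\,\Delta(\varphi)\, tw(\varphi)^2}\cdot n$ nodes.
   Context: A CNF $\varphi$ is a set of clauses, each clause a set of literals; $Var(\varphi)$ is the set of its variables. The primal graph $G_\varphi$ has vertex set $Var(\varphi)$, two variables being adjacent iff they occur together in some clause; $tw(\varphi)$ is the treewidth of $G_\varphi$. $\Delta(\varphi)$ is the maximum, over variables $x$, of the number of clauses of $\varphi$ in which $x$ occurs. An OBDD is a DAG (multiple edges allowed) with one source and two sinks labelled $True$ and $False$, in which each non-sink node has two outgoing edges labelled with opposite literals of the same variable, no path contains two edges labelled with literals of the same variable, and there is a linear order $\pi$ of the variables such that along every path the variables appear in increasing $\pi$-order. The function $F(Z)$ computed by OBDD $Z$ has as satisfying assignments exactly the assignments $S$ to $Var(Z)$ (the variables labelling edges) such that some source-to-$True$ path $P$ has all its edge labels in $S$. The conjunction of OBDDs $Z_1,Z_2$ is the function $F(Z_1)\wedge F(Z_2)$; it represents $\varphi$ if it has the same satisfying assignments as $\varphi$. Size is measured by the number of nodes.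
   Formalization: Valid CNFs are excluded (no OBDD as defined is constant), and so are CNFs with tw = 0 and at most 4 variables, where the bound is just n and fails e.g. for {{x}}; a few small CNFs of the latter kind for which the claim holds are also excluded. Variables are natural numbers. *)

theory Defs
  imports Complex_Main "Graph_Theory.Graph_Theory"
begin

section \<open>CNFs\<close>

datatype 'v literal = Pos 'v | Neg 'v

primrec lit_var :: "'v literal \<Rightarrow> 'v" where
  "lit_var (Pos x) = x"
| "lit_var (Neg x) = x"

primrec lit_neg :: "'v literal \<Rightarrow> 'v literal" where
  "lit_neg (Pos x) = Neg x"
| "lit_neg (Neg x) = Pos x"

type_synonym 'v clause = "'v literal set"
type_synonym 'v cnf = "'v clause set"

text \<open>A clause may contain a variable together with its negation.\<close>

definition is_cnf :: "'v cnf \<Rightarrow> bool" where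
  "is_cnf \<phi> \<longleftrightarrow> finite \<phi> \<and> (\<forall>C\<in>\<phi>. finite C)"

definition clause_vars :: "'v clause \<Rightarrow> 'v set" where
  "clause_vars C = lit_var ` C"

definition cnf_vars :: "'v cnf \<Rightarrow> 'v set" where
  "cnf_vars \<phi> = (\<Union>C\<in>\<phi>. clause_vars C)"

text \<open>
  An assignment to \<open>X\<close> is identified with the set of literals that it makes true.
\<close>

definition assignments :: "'v set \<Rightarrow> 'v literal set set" where
  "assignments X = {S. lit_var ` S \<subseteq> X \<and> (\<forall>x\<in>X. Pos x \<in> S \<longleftrightarrow> Neg x \<notin> S)}"

definition restrict_assignment :: "'v literal set \<Rightarrow> 'v set \<Rightarrow> 'v literal set" where
  "restrict_assignment S X = {l \<in> S. lit_var l \<in> X}"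

definition cnf_models :: "'v cnf \<Rightarrow> 'v literal set set" where
  "cnf_models \<phi> = {S \<in> assignments (cnf_vars \<phi>). \<forall>C\<in>\<phi>. C \<inter> S \<noteq> {}}"

text \<open>This is unspecified (\<open>Max {}\<close>) for a CNF without variables.\<close>

definition cnf_Delta :: "'v cnf \<Rightarrow> nat" where
  "cnf_Delta \<phi> = Max ((\<lambda>x. card {C \<in> \<phi>. x \<in> clause_vars C}) ` cnf_vars \<phi>)"


section \<open>Treewidth\<close>

text \<open>
  Undirected graphs are symmetric digraphs, so each edge yields a directed cycle of length 2;
  the cycles of the undirected graph are the directed cycles of length at least 3.
  For the same reason \<open>Digraph_Component.tree\<close>, which forbids all directed cycles, is not
  the notion of an undirected tree.
\<close>

definition undirected_tree :: "'t pair_pre_digraph \<Rightarrow> bool" where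
  "undirected_tree T \<longleftrightarrow> pair_graph T \<and> Digraph_Component.connected (with_proj T) \<and>
     \<not> (\<exists>p. pre_digraph.cycle (with_proj T) p \<and> 3 \<le> length p)"

definition tree_decomposition ::
    "'a pair_pre_digraph \<Rightarrow> 't pair_pre_digraph \<Rightarrow> ('t \<Rightarrow> 'a set) \<Rightarrow> bool" where
  "tree_decomposition G T B \<longleftrightarrow>
     undirected_tree T \<and>
     (\<Union>t\<in>pverts T. B t) = pverts G \<and>
     (\<forall>(u, v)\<in>parcs G. \<exists>t\<in>pverts T. u \<in> B t \<and> v \<in> B t) \<and>
     (\<forall>v\<in>pverts G. Digraph_Component.connected
        (induce_subgraph (with_proj T) {t \<in> pverts T. v \<in> B t}))"

text \<open>Natural-number subtraction makes the treewidth of the graph without vertices 0.\<close>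

definition decomposition_width :: "'t pair_pre_digraph \<Rightarrow> ('t \<Rightarrow> 'a set) \<Rightarrow> nat" where
  "decomposition_width T B = Max ((\<lambda>t. card (B t)) ` pverts T) - 1"

text \<open>Trees are finite, so natural numbers suffice as nodes of decomposition trees.\<close>

definition treewidth :: "'a pair_pre_digraph \<Rightarrow> nat" where
  "treewidth G = (LEAST w. \<exists>(T :: nat pair_pre_digraph) B.
     tree_decomposition G T B \<and> decomposition_width T B = w)"

definition primal_graph :: "'v cnf \<Rightarrow> 'v pair_pre_digraph" where
  "primal_graph \<phi> = \<lparr> pverts = cnf_vars \<phi>,
     parcs = {(x, y). x \<noteq> y \<and> (\<exists>C\<in>\<phi>. x \<in> clause_vars C \<and> y \<in> clause_vars C)} \<rparr>"

definition cnf_tw :: "'v cnf \<Rightarrow> nat" where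
  "cnf_tw \<phi> = treewidth (primal_graph \<phi>)"


section \<open>OBDDs\<close>

record ('n, 'e, 'v) obdd =
  dag :: "('n, 'e) pre_digraph"
  lab :: "'e \<Rightarrow> 'v literal"
  true_sink :: 'n
  false_sink :: 'n

definition is_source :: "('n, 'e) pre_digraph \<Rightarrow> 'n \<Rightarrow> bool" where
  "is_source G v \<longleftrightarrow> v \<in> verts G \<and> in_arcs G v = {}"

definition is_sink :: "('n, 'e) pre_digraph \<Rightarrow> 'n \<Rightarrow> bool" where
  "is_sink G v \<longleftrightarrow> v \<in> verts G \<and> out_arcs G v = {}"

definition obdd_vars :: "('n, 'e, 'v) obdd \<Rightarrow> 'v set" where
  "obdd_vars Z = lit_var ` lab Z ` arcs (dag Z)"

definition is_obdd :: "('n, 'e, 'v) obdd \<Rightarrow> bool" where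
  "is_obdd Z \<longleftrightarrow>
     fin_digraph (dag Z) \<and>
     \<not> (\<exists>p. pre_digraph.cycle (dag Z) p) \<and>
     (\<exists>!s. is_source (dag Z) s) \<and>
     {v. is_sink (dag Z) v} = {true_sink Z, false_sink Z} \<and>
     true_sink Z \<noteq> false_sink Z \<and>
     (\<forall>v\<in>verts (dag Z). \<not> is_sink (dag Z) v \<longrightarrow>
        (\<exists>e1 e2. e1 \<noteq> e2 \<and> out_arcs (dag Z) v = {e1, e2} \<and> lab Z e2 = lit_neg (lab Z e1))) \<and>
     (\<forall>u p v. pre_digraph.awalk (dag Z) u p v \<longrightarrow> distinct (map (lit_var \<circ> lab Z) p)) \<and>
     (\<exists>\<pi>. linear_order_on (obdd_vars Z) \<pi> \<and>
        (\<forall>u p v. pre_digraph.awalk (dag Z) u p v \<longrightarrow>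
           sorted_wrt (\<lambda>x y. (x, y) \<in> \<pi>) (map (lit_var \<circ> lab Z) p)))"

definition obdd_models :: "('n, 'e, 'v) obdd \<Rightarrow> 'v literal set set" where
  "obdd_models Z = {S \<in> assignments (obdd_vars Z).
     \<exists>s p. is_source (dag Z) s \<and> pre_digraph.awalk (dag Z) s p (true_sink Z) \<and>
       lab Z ` set p \<subseteq> S}"

definition conjunction_models ::
    "('n, 'e, 'v) obdd \<Rightarrow> ('n, 'e, 'v) obdd \<Rightarrow> 'v literal set set" where
  "conjunction_models Z1 Z2 = {S \<in> assignments (obdd_vars Z1 \<union> obdd_vars Z2).
     restrict_assignment S (obdd_vars Z1) \<in> obdd_models Z1 \<and>
     restrict_assignment S (obdd_vars Z2) \<in> obdd_models Z2}"

definition conjunction_represents ::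
    "('n, 'e, 'v) obdd \<Rightarrow> ('n, 'e, 'v) obdd \<Rightarrow> 'v cnf \<Rightarrow> bool" where
  "conjunction_represents Z1 Z2 \<phi> \<longleftrightarrow> conjunction_models Z1 Z2 = cnf_models \<phi>"

definition obdd_size :: "('n, 'e, 'v) obdd \<Rightarrow> nat" where
  "obdd_size Z = card (verts (dag Z))"


section \<open>Degenerate CNFs\<close>

text \<open>
  In an OBDD both sinks are reachable from the unique source, along paths that never repeat a
  variable, so an OBDD never computes a constant function and no conjunction of OBDDs
  represents a valid CNF.

  If \<open>tw(\<phi>) = 0\<close>, the bound \<open>2^(2 \<gamma> \<Delta>(\<phi>) tw(\<phi>)^2) n\<close> is \<open>n\<close> for every \<open>\<gamma>\<close>, whereas
  an OBDD has at least 3 nodes, and at least \<open>k + 2\<close> if it has \<open>k\<close> variables. Hence the bound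
  fails for \<open>n < 3\<close>, for \<open>{{x}, {y}, {z}}\<close>, and, with \<open>n = 4\<close>, for
  \<open>{{w}, {x, \<not>x}, {y, \<not>y}, {z, \<not>z}}\<close>.
\<close>

definition falsifiable :: "'v cnf \<Rightarrow> bool" where
  "falsifiable \<phi> \<longleftrightarrow> cnf_models \<phi> \<noteq> assignments (cnf_vars \<phi>)"

end

theory Submission
  imports Defs "HOL-Library.Nat_Bijection"
begin

text \<open>
  A graph of treewidth \<open>k\<close> and maximum degree \<open>d\<close> has a tree-partition whose bags have size
  \<open>O(k d)\<close> (Ding and Oporowski): the vertices are partitioned into the nodes of a tree so that every
  edge stays within a bag or joins adjacent bags. In the primal graph \<open>d \<le> \<Delta> k\<close>, and every
  clause is a clique, hence contained in the union of a bag and its parent. Sorting the clauses by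
  the parity of the level of the parent splits the CNF into two parts, each of which falls apart
  into stars of bags. Reading the variables star by star, the centre first and then one leaf bag
  after the other, only \<open>O(\<Delta> k\<^sup>2)\<close> of the variables read so far ever occur in a clause with a later
  variable, and an OBDD needs to remember only their values.
\<close>

section \<open>Rooted tree decompositions and balanced separators\<close>

text \<open>No tree-partition is ever formed: the recursion that would build one maintains the two
  layouts directly. It carries a set \<open>S\<close> that the root bag must contain. If
  \<open>S\<close> is small, its neighbours, at most \<open>d\<close> per vertex, become the set
  required of the rest; if \<open>S\<close> is large, a separator of size at most \<open>K\<close>
  that is balanced with respect to \<open>S\<close> gives two smaller problems sharing only the
  separator. With \<open>K\<close> one more than the treewidth and \<open>d\<close> the product of
  \<Delta> and the treewidth, the bound on root bags is \<open>24 * K * d\<close> and that on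
  boundaries \<open>48 * K * d\<close>. The obstacle on the OBDD side is that an OBDD is never
  constant and has two sinks besides its decision nodes. Unsatisfiable formulas and valid parts
  therefore need their own treatment, and the sinks must be absorbed by the constant in the
  exponent. At treewidth 0 the bound is just \<open>n\<close>, no constant helps, and the variables
  themselves are divided between the two OBDDs.\<close>

locale sym_graph =
  fixes E :: "'a \<Rightarrow> 'a \<Rightarrow> bool"
  assumes sym: "E u v \<Longrightarrow> E v u"
begin

definition clique :: "'a set \<Rightarrow> bool" where
  "clique Q \<longleftrightarrow> (\<forall>x\<in>Q. \<forall>y\<in>Q. x \<noteq> y \<longrightarrow> E x y)"

definition no_edge :: "'a set \<Rightarrow> 'a set \<Rightarrow> bool" where
  "no_edge A B \<longleftrightarrow> (\<forall>x\<in>A. \<forall>y\<in>B. \<not> E x y)"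

lemma no_edge_commute: "no_edge A B \<longleftrightarrow> no_edge B A"
  unfolding no_edge_def using sym by blast

lemma clique_Un_cases:
  assumes "clique Q" "Q \<subseteq> V \<union> U" "no_edge (V - U) (U - V)"
  shows "Q \<subseteq> V \<or> Q \<subseteq> U"
proof (rule ccontr)
  assume "\<not> ?thesis"
  then obtain x y where "x \<in> Q" "x \<notin> V" "y \<in> Q" "y \<notin> U" by blast
  then have "y \<in> V - U" "x \<in> U - V" "E y x"
    using assms unfolding clique_def by (blast, blast, metis subsetD UnE)
  then show False using assms unfolding no_edge_def by blast
qed

text \<open>
  \<open>tree_bags K X \<B> V\<close>: the graph induced on \<open>V\<close> has a tree decomposition with bags \<open>\<B>\<close> of size at
  most \<open>K\<close>, rooted at the bag \<open>X\<close>. The rule \<open>glue\<close> makes the root of one tree a child of the root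
  of another; recording \<open>\<B>\<close> makes it possible to attach a bag below any other bag.
\<close>

inductive tree_bags :: "nat \<Rightarrow> 'a set \<Rightarrow> 'a set set \<Rightarrow> 'a set \<Rightarrow> bool" for K where
  single: "finite X \<Longrightarrow> card X \<le> K \<Longrightarrow> tree_bags K X {X} X"
| glue: "tree_bags K X \<B> V \<Longrightarrow> tree_bags K Y \<C> U \<Longrightarrow> V \<inter> U \<subseteq> X \<inter> Y \<Longrightarrow>
    no_edge (V - U) (U - V) \<Longrightarrow> tree_bags K X (\<B> \<union> \<C>) (V \<union> U)"

lemma tree_bags_facts:
  assumes "tree_bags K X \<B> V"
  shows "finite V \<and> X \<subseteq> V \<and> card X \<le> K \<and> \<Union>\<B> \<subseteq> V"
  using assms by induction auto

text \<open>\<open>glue\<close> attaches only at roots, whereas undoing the removal of a leaf needs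
  attachment at an arbitrary bag \<open>Y\<close>. In the induction \<open>Y\<close> lies in one of
  the two glued parts and \<open>Z\<close> meets the other part only inside \<open>Y\<close>, so
  \<open>Z\<close> can be added to the part of \<open>Y\<close> and the gluing repeated.\<close>

lemma tree_bags_add_leaf:
  assumes "tree_bags K X \<B> V" "Y \<in> \<B>" "finite Z" "card Z \<le> K" "Z \<inter> V \<subseteq> Y" "no_edge (Z - V) (V - Z)"
  shows "tree_bags K X (insert Z \<B>) (V \<union> Z)"
  using assms
proof (induction rule: tree_bags.induct)
  case (single X)
  have "X \<inter> Z \<subseteq> X \<inter> Z" "no_edge (X - Z) (Z - X)"
    using single no_edge_commute by auto
  then have "tree_bags K X ({X} \<union> {Z}) (X \<union> Z)"
    using tree_bags.glue[OF tree_bags.single tree_bags.single] single by metis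
  then show ?case by (simp add: insert_commute)
next
  case (glue X \<B> V Y' \<C> U)
  note facts = tree_bags_facts[OF glue.hyps(1)] tree_bags_facts[OF glue.hyps(2)]
  have nVU: "no_edge (V - U) (U - V)" by fact
  have nZ: "no_edge (Z - (V \<union> U)) ((V \<union> U) - Z)" by fact
  show ?case
  proof (cases "Y \<in> \<B>")
    case True
    then have YV: "Y \<subseteq> V" using facts by blast
    have "no_edge (Z - V) (V - Z)"
      using nZ nVU glue.prems(4) YV unfolding no_edge_def by blast
    then have "tree_bags K X (insert Z \<B>) (V \<union> Z)"
      using glue.IH(1) True glue.prems by blast
    then have "tree_bags K X (insert Z \<B> \<union> \<C>) ((V \<union> Z) \<union> U)"
    proof (rule tree_bags.glue[OF _ glue.hyps(2)])
      show "(V \<union> Z) \<inter> U \<subseteq> X \<inter> Y'" using glue.hyps(3) glue.prems(4) YV by blast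
      show "no_edge ((V \<union> Z) - U) (U - (V \<union> Z))"
        using nZ nVU unfolding no_edge_def by blast
    qed
    then show ?thesis by (simp add: Un_ac)
  next
    case False
    then have YC: "Y \<in> \<C>" using glue.prems by blast
    then have YU: "Y \<subseteq> U" using facts by blast
    have "no_edge (Z - U) (U - Z)"
      using nZ nVU glue.prems(4) YU sym unfolding no_edge_def by blast
    then have "tree_bags K Y' (insert Z \<C>) (U \<union> Z)"
      using glue.IH(2) YC glue.prems by blast
    then have "tree_bags K X (\<B> \<union> insert Z \<C>) (V \<union> (U \<union> Z))"
    proof (rule tree_bags.glue[OF glue.hyps(1)])
      show "V \<inter> (U \<union> Z) \<subseteq> X \<inter> Y'" using glue.hyps(3) glue.prems(4) YU by blast
      show "no_edge (V - (U \<union> Z)) (U \<union> Z - V)"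
        using nZ nVU sym unfolding no_edge_def by blast
    qed
    then show ?thesis by (simp add: Un_ac)
  qed
qed

text \<open>Intersecting every bag with \<open>W\<close> keeps the shape of the derivation; this
  lets the later recursion pass to vertex subsets with the same \<open>K\<close>.\<close>

lemma tree_bags_restrict:
  assumes "tree_bags K X \<B> V"
  shows "\<exists>\<C>. tree_bags K (X \<inter> W) \<C> (V \<inter> W)"
  using assms
proof induction
  case (single X)
  have "card (X \<inter> W) \<le> K" using single card_mono[of X "X \<inter> W"] by simp
  then show ?case using tree_bags.single[of "X \<inter> W"] single by blast
next
  case (glue X \<B> V Y \<C> U)
  then obtain \<B>' \<C>' where *: "tree_bags K (X \<inter> W) \<B>' (V \<inter> W)" "tree_bags K (Y \<inter> W) \<C>' (U \<inter> W)"
    by blast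
  have "tree_bags K (X \<inter> W) (\<B>' \<union> \<C>') ((V \<inter> W) \<union> (U \<inter> W))"
    using * by (rule tree_bags.glue) (use glue.hyps in \<open>auto simp: no_edge_def\<close>)
  then show ?case by (auto simp: Int_Un_distrib2)
qed

text \<open>No clique straddles a gluing, so it descends to a single bag. This will bound the number
  of variables in a clause.\<close>

lemma tree_bags_clique:
  assumes "tree_bags K X \<B> V" "clique Q" "Q \<subseteq> V"
  shows "card Q \<le> K"
  using assms
proof induction
  case (single X) then show ?case using card_mono[of X Q] by simp
next
  case (glue X \<B> V Y \<C> U) then show ?case using clique_Un_cases by blast
qed

lemma no_edge_extend:
  assumes "no_edge (A - Z) (V - A)" "A \<subseteq> V" "A \<inter> U \<subseteq> Z" "no_edge (V - U) (U - V)"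
  shows "no_edge (A - Z) (V \<union> U - A)"
  unfolding no_edge_def
proof (intro ballI)
  fix x y assume x: "x \<in> A - Z" and y: "y \<in> V \<union> U - A"
  show "\<not> E x y"
  proof (cases "y \<in> V")
    case True
    then show ?thesis using assms(1) x y unfolding no_edge_def by auto
  next
    case False
    then have "x \<in> V - U" "y \<in> U - V" using assms(2,3) x y by auto
    then show ?thesis using assms(4) unfolding no_edge_def by simp
  qed
qed

text \<open>Descend into a glued part that holds at least a third of \<open>S\<close> for as long as
  there is one. The descent stops at a subtree \<open>A\<close> with root bag \<open>Z\<close> whose
  two parts hold less than a third each, hence at most two thirds together. The conjunct
  \<open>A \<inter> X \<subseteq> Z\<close> is the invariant that carries the separation back up
  through the gluings.\<close>

lemma tree_bags_separator:
  assumes "tree_bags K X \<B> V" "finite S" "3 * K < card S" "card S \<le> 3 * card (V \<inter> S)"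
  shows "\<exists>A Z. Z \<subseteq> A \<and> A \<subseteq> V \<and> card Z \<le> K \<and> A \<inter> X \<subseteq> Z \<and> no_edge (A - Z) (V - A) \<and>
    card S \<le> 3 * card (A \<inter> S) \<and> 3 * card (A \<inter> S) \<le> 2 * card S"
  using assms
proof induction
  case (single X)
  \<comment> \<open>A single bag holds less than a third of \<open>S\<close>, so the descent never
    ends here.\<close>
  then have "card (X \<inter> S) \<le> K" using card_mono[of X "X \<inter> S"] by simp
  then show ?case using single by linarith
next
  case (glue X \<B> V Y \<C> U)
  note f = tree_bags_facts[OF glue.hyps(1)] tree_bags_facts[OF glue.hyps(2)]
  have n: "no_edge (V - U) (U - V)" by fact
  consider "card S \<le> 3 * card (V \<inter> S)" | "card S \<le> 3 * card (U \<inter> S)"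
    | "3 * card (V \<inter> S) < card S" "3 * card (U \<inter> S) < card S" by linarith
  then show ?case
  proof cases
    case 1
    then obtain A Z where A: "Z \<subseteq> A" "A \<subseteq> V" "card Z \<le> K" "A \<inter> X \<subseteq> Z" "no_edge (A - Z) (V - A)"
      "card S \<le> 3 * card (A \<inter> S)" "3 * card (A \<inter> S) \<le> 2 * card S"
      using glue.IH(1)[OF glue.prems(1,2) 1] by (elim exE conjE) (rule that; assumption)
    have "A \<inter> U \<subseteq> Z" using A(2,4) glue.hyps(3) by blast
    then have "no_edge (A - Z) (V \<union> U - A)"
      by (rule no_edge_extend[OF A(5,2) _ n])
    then show ?thesis using A by (intro exI[of _ A] exI[of _ Z]) auto
  next
    case 2
    then obtain A Z where A: "Z \<subseteq> A" "A \<subseteq> U" "card Z \<le> K" "A \<inter> Y \<subseteq> Z" "no_edge (A - Z) (U - A)"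
      "card S \<le> 3 * card (A \<inter> S)" "3 * card (A \<inter> S) \<le> 2 * card S"
      using glue.IH(2)[OF glue.prems(1,2) 2] by (elim exE conjE) (rule that; assumption)
    have "A \<inter> V \<subseteq> Z" using A(2,4) glue.hyps(3) by blast
    moreover have "no_edge (U - V) (V - U)" using n no_edge_commute by blast
    ultimately have "no_edge (A - Z) (U \<union> V - A)" by (rule no_edge_extend[OF A(5,2)])
    then have "no_edge (A - Z) (V \<union> U - A)" by (simp add: Un_commute)
    moreover have "X \<subseteq> V" using f by blast
    then have "A \<inter> X \<subseteq> Z" using \<open>A \<inter> V \<subseteq> Z\<close> by blast
    ultimately show ?thesis using A by (intro exI[of _ A] exI[of _ Z]) auto
  next
    case 3
    have "card ((V \<union> U) \<inter> S) \<le> card (V \<inter> S) + card (U \<inter> S)"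
      by (metis Int_Un_distrib2 card_Un_le)
    then show ?thesis using 3 f glue.prems
      by (intro exI[of _ "V \<union> U"] exI[of _ X]) (auto simp: no_edge_def)
  qed
qed

end

section \<open>Two layouts from a tree-partition\<close>

definition boundary :: "'a set set \<Rightarrow> 'a set \<Rightarrow> 'a set \<Rightarrow> 'a set" where
  "boundary \<H> P T = {v \<in> P. \<exists>H\<in>\<H>. v \<in> H \<and> H \<inter> T \<noteq> {}}"

text \<open>A hypergraph form of the vertex separation number, the linear-layout view of pathwidth.
  For clause scopes as hyperedges, the boundary at a cut is what an OBDD reading along
  \<open>L\<close> has to remember.\<close>

definition layout :: "nat \<Rightarrow> 'a set set \<Rightarrow> 'a list \<Rightarrow> bool" where
  "layout b \<H> L \<longleftrightarrow> distinct L \<and> \<Union>\<H> \<subseteq> set L \<and>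
     (\<forall>P T. L = P @ T \<longrightarrow> card (boundary \<H> (set P) (set T)) \<le> b)"

lemma boundary_Un: "boundary (\<G> \<union> \<H>) P T = boundary \<G> P T \<union> boundary \<H> P T"
  by (auto simp: boundary_def)

lemma boundary_Un_disjoint: "\<Union>\<H> \<inter> T' = {} \<Longrightarrow> boundary \<H> P (T \<union> T') = boundary \<H> P T"
  "\<Union>\<H> \<inter> P' = {} \<Longrightarrow> boundary \<H> (P' \<union> P) T = boundary \<H> P T"
  unfolding boundary_def by blast+

lemma boundary_empty: "\<Union>\<H> \<inter> P = {} \<Longrightarrow> boundary \<H> P T = {}" "\<Union>\<H> \<inter> T = {} \<Longrightarrow> boundary \<H> P T = {}"
  unfolding boundary_def by blast+

text \<open>Every hyperedge stays within one of the two disjoint lists, so only the block being cut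
  contributes and \<open>b\<close> does not grow.\<close>

lemma layout_append:
  assumes "layout b \<G> K" "layout b \<H> L" "set K \<inter> set L = {}"
  shows "layout b (\<G> \<union> \<H>) (K @ L)"
  unfolding layout_def
proof (intro conjI allI impI)
  show "distinct (K @ L)" "\<Union>(\<G> \<union> \<H>) \<subseteq> set (K @ L)" using assms by (auto simp: layout_def)
  have sub: "\<Union>\<G> \<subseteq> set K" "\<Union>\<H> \<subseteq> set L" using assms by (simp_all add: layout_def)
  fix P T assume "K @ L = P @ T"
  then consider us where "K = P @ us" "T = us @ L" | us where "P = K @ us" "L = us @ T"
    by (auto simp: append_eq_append_conv2)
  then show "card (boundary (\<G> \<union> \<H>) (set P) (set T)) \<le> b"
  proof cases
    case 1
    have "\<Union>\<H> \<inter> set P = {}" "\<Union>\<G> \<inter> set L = {}" using sub assms(3) 1 by auto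
    then have "boundary (\<G> \<union> \<H>) (set P) (set T) = boundary \<G> (set P) (set us)"
      using 1 by (simp add: boundary_Un boundary_Un_disjoint boundary_empty)
    then show ?thesis using 1 assms by (simp add: layout_def)
  next
    case 2
    have "\<Union>\<G> \<inter> set T = {}" "\<Union>\<H> \<inter> set K = {}" using sub assms(3) 2 by auto
    then have "boundary (\<G> \<union> \<H>) (set P) (set T) = boundary \<H> (set us) (set T)"
      using 2 by (simp add: boundary_Un boundary_Un_disjoint boundary_empty)
    then show ?thesis using 2 assms by (simp add: layout_def)
  qed
qed

lemma layout_small:
  assumes "distinct L" "length L \<le> b" "\<Union>\<H> \<subseteq> set L"
  shows "layout b \<H> L"
  unfolding layout_def
proof (intro conjI allI impI)
  fix P T assume "L = P @ T"
  then have "card (boundary \<H> (set P) (set T)) \<le> card (set P)"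
    by (intro card_mono) (auto simp: boundary_def)
  also have "\<dots> \<le> length L" using \<open>L = P @ T\<close> card_length[of P] by simp
  finally show "card (boundary \<H> (set P) (set T)) \<le> b" using assms by simp
qed (use assms in auto)

lemma layout_mono: "layout b \<H> L \<Longrightarrow> b \<le> c \<Longrightarrow> layout c \<H> L"
  unfolding layout_def using order_trans by blast

text \<open>While the centre \<open>R\<close> is being read, at most \<open>w\<close> vertices have
  been read at all; afterwards \<open>R\<close> may have to be remembered in addition to a boundary
  among the leaves. The factor is thus 2, however many leaves there are.\<close>

lemma layout_star:
  assumes "distinct R" "length R \<le> w" "layout w \<H> cs" "set R \<inter> set cs = {}"
  shows "layout (2 * w) {H. H \<subseteq> set R \<union> set cs \<and> H - set R \<in> \<H>} (R @ cs)"
  unfolding layout_def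
proof (intro conjI allI impI)
  show "distinct (R @ cs)" using assms by (auto simp: layout_def)
  show "\<Union>{H. H \<subseteq> set R \<union> set cs \<and> H - set R \<in> \<H>} \<subseteq> set (R @ cs)" by auto
  fix P T assume "R @ cs = P @ T"
  then consider us where "R = P @ us" "T = us @ cs" | us where "P = R @ us" "cs = us @ T"
    by (auto simp: append_eq_append_conv2)
  then show "card (boundary {H. H \<subseteq> set R \<union> set cs \<and> H - set R \<in> \<H>} (set P) (set T)) \<le> 2 * w"
    (is "card ?B \<le> _")
  proof cases
    case 1
    have "card ?B \<le> card (set P)" by (intro card_mono) (auto simp: boundary_def)
    also have "\<dots> \<le> length R" using 1 card_length[of P] by simp
    finally show ?thesis using assms by simp
  next
    case 2
    have "?B \<subseteq> set R \<union> boundary \<H> (set us) (set T)"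
    proof
      fix v assume "v \<in> ?B"
      then obtain H where H: "H - set R \<in> \<H>" "v \<in> H" "H \<inter> set T \<noteq> {}" "v \<in> set P"
        by (auto simp: boundary_def)
      have "(H - set R) \<inter> set T \<noteq> {}" using H 2 assms by auto
      then show "v \<in> set R \<union> boundary \<H> (set us) (set T)"
        using H(1,2,4) 2(1) unfolding boundary_def by auto
    qed
    then have "card ?B \<le> card (set R \<union> boundary \<H> (set us) (set T))"
      by (intro card_mono) (auto simp: boundary_def)
    also have "\<dots> \<le> card (set R) + card (boundary \<H> (set us) (set T))" by (rule card_Un_le)
    also have "\<dots> \<le> w + w"
      using assms 2 card_length[of R] by (intro add_mono) (auto simp: layout_def)
    finally show ?thesis by simp
  qed
qed

section \<open>Maintaining both layouts along the recursion\<close>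

context sym_graph begin

text \<open>
  The layouts read off a tree-partition of \<open>V\<close> with root bag \<open>R\<close>, without the bag \<open>R\<close>. The first
  layout is cut into \<open>cs\<close>, the children of \<open>R\<close>, and \<open>es\<close>, the stars centred at even levels below
  the root; the second one, \<open>os\<close>, consists of the stars centred at odd levels. The set \<open>R\<close> is left
  out, and removed from the cliques in \<open>\<H>s\<close>, so that the star of \<open>R\<close> can still be merged with
  another one.
\<close>

definition two_layouts :: "nat \<Rightarrow> 'a set \<Rightarrow> 'a set \<Rightarrow> bool" where
  "two_layouts w R V \<longleftrightarrow> R \<subseteq> V \<and> (\<exists>cs \<H>s es \<H>e os \<H>o.
     layout w \<H>s cs \<and> layout (2 * w) \<H>e es \<and> layout (2 * w) \<H>o os \<and>
     set cs \<inter> set es = {} \<and> V - R = set cs \<union> set es \<and> V - R = set os \<and>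
     (\<forall>Q. Q \<subseteq> V \<longrightarrow> clique Q \<longrightarrow> Q - R \<in> \<H>s \<or> Q \<in> \<H>e \<or> Q \<in> \<H>o))"

lemma two_layoutsI:
  assumes "layout w \<H>s cs" "layout (2 * w) \<H>e es" "layout (2 * w) \<H>o os" "R \<subseteq> V"
    "set cs \<inter> set es = {}" "V - R = set cs \<union> set es" "V - R = set os"
    "\<And>Q. Q \<subseteq> V \<Longrightarrow> clique Q \<Longrightarrow> Q - R \<in> \<H>s \<or> Q \<in> \<H>e \<or> Q \<in> \<H>o"
  shows "two_layouts w R V"
  unfolding two_layouts_def using assms
  by (intro conjI exI[of _ cs] exI[of _ \<H>s] exI[of _ es] exI[of _ \<H>e] exI[of _ os] exI[of _ \<H>o]) simp_all

lemma two_layoutsE: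
  assumes "two_layouts w R V"
  obtains cs \<H>s es \<H>e os \<H>o where
    "layout w \<H>s cs" "layout (2 * w) \<H>e es" "layout (2 * w) \<H>o os"
    "set cs \<inter> set es = {}" "V - R = set cs \<union> set es" "V - R = set os"
    "\<forall>Q. Q \<subseteq> V \<longrightarrow> clique Q \<longrightarrow> Q - R \<in> \<H>s \<or> Q \<in> \<H>e \<or> Q \<in> \<H>o" "R \<subseteq> V"
  using assms unfolding two_layouts_def by (elim conjE exE) (rule that; assumption)

text \<open>\<open>V - R\<close> becomes a single leaf bag below the centre \<open>R\<close>, which
  takes care of every clique.\<close>

lemma two_layouts_base:
  assumes "finite V" "card (V - R) \<le> w" "R \<subseteq> V"
  shows "two_layouts w R V"
proof -
  obtain cs where cs: "set cs = V - R" "distinct cs"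
    using finite_distinct_list[of "V - R"] assms by auto
  have "length cs \<le> w" using cs assms distinct_card[of cs] by simp
  then have "layout w (Pow (V - R)) cs" "layout (2 * w) {} []" "layout (2 * w) {} cs"
    using cs by (auto intro!: layout_small)
  then show ?thesis
    by (rule two_layoutsI) (use cs assms in auto)
qed

text \<open>The new root moves every bag one level down, so the parities swap: \<open>os\<close> now
  holds the even stars, while the star of \<open>C\<close> is complete and joins \<open>es\<close>
  in the odd layout. \<open>C\<close> is the only child of \<open>R\<close>, and whatever a clique
  meeting \<open>R\<close> has outside \<open>R\<close> lies in \<open>C\<close>.\<close>

lemma two_layouts_grow:
  assumes "two_layouts w C U" "finite U" "card C \<le> w" "R \<inter> U = {}" "no_edge R (U - C)"
  shows "two_layouts w R (R \<union> U)"
proof -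
  obtain cs \<H>s es \<H>e os \<H>o where *:
    "layout w \<H>s cs" "layout (2 * w) \<H>e es" "layout (2 * w) \<H>o os"
    "set cs \<inter> set es = {}" "U - C = set cs \<union> set es" "U - C = set os"
    and Qa: "\<forall>Q. Q \<subseteq> U \<longrightarrow> clique Q \<longrightarrow> Q - C \<in> \<H>s \<or> Q \<in> \<H>e \<or> Q \<in> \<H>o"
    and CU: "C \<subseteq> U"
    by (rule two_layoutsE[OF assms(1)])
  obtain Cl where Cl: "set Cl = C" "distinct Cl"
    using finite_distinct_list[of C] finite_subset[OF CU assms(2)] by blast
  have len: "length Cl \<le> w" using Cl assms distinct_card[of Cl] by simp
  let ?A = "{H. H \<subseteq> set Cl \<union> set cs \<and> H - set Cl \<in> \<H>s}"
  have disj: "set Cl \<inter> set cs = {}" "set Cl \<inter> set es = {}" using * Cl by auto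
  have even: "layout (2 * w) (?A \<union> \<H>e) ((Cl @ cs) @ es)"
    by (rule layout_append[OF layout_star[OF Cl(2) len *(1) disj(1)] *(2)]) (use disj *(4) in auto)
  have star: "layout w (Pow C) Cl" using Cl len by (intro layout_small) auto
  have Q: "Q - R \<in> Pow C \<or> Q \<in> \<H>o \<or> Q \<in> ?A \<union> \<H>e" if "Q \<subseteq> R \<union> U" "clique Q" for Q
  proof (cases "Q \<inter> R = {}")
    case True
    then have QU: "Q \<subseteq> U" using that by blast
    have "Q \<in> ?A" if "Q - C \<in> \<H>s"
    proof -
      have "Q - C \<subseteq> set cs" using that *(1) by (auto simp: layout_def)
      then show ?thesis using that Cl(1) by auto
    qed
    then show ?thesis using Qa[rule_format, OF QU that(2)] by blast
  next
    case False
    then obtain r where r: "r \<in> Q" "r \<in> R" by blast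
    have "x \<in> C" if x: "x \<in> Q - R" for x
    proof (rule ccontr)
      assume "x \<notin> C"
      then have "x \<in> U - C" using x \<open>Q \<subseteq> R \<union> U\<close> by blast
      moreover have "E r x" using x r \<open>clique Q\<close> unfolding clique_def by auto
      ultimately show False using r assms(5) unfolding no_edge_def by blast
    qed
    then have "Q - R \<subseteq> C" by blast
    then show ?thesis by blast
  qed
  have "U = set cs \<union> set es \<union> set Cl" "U = set Cl \<union> set os" using *(5,6) CU Cl(1) by blast+
  then have sets: "R \<union> U - R = set Cl \<union> set os" "R \<union> U - R = set ((Cl @ cs) @ es)"
    using assms(4) by auto
  have "set Cl \<inter> set os = {}" using *(6) Cl(1) by blast
  show ?thesis
    by (rule two_layoutsI[OF star *(3) even _ \<open>set Cl \<inter> set os = {}\<close> sets Q]) auto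
qed

text \<open>The tree-partitions overlap only inside their root bags, so uniting these leaves the
  remainders disjoint and the layouts can be concatenated. The lists of children keep width
  \<open>w\<close> because the root bag is not part of them.\<close>

lemma two_layouts_merge:
  assumes 1: "two_layouts w R V" and 2: "two_layouts w C U"
    and i: "V \<inter> U \<subseteq> R \<inter> C" and n: "no_edge (V - U) (U - V)"
  shows "two_layouts w (R \<union> C) (V \<union> U)"
proof -
  obtain cs \<H>s es \<H>e os \<H>o where *:
    "layout w \<H>s cs" "layout (2 * w) \<H>e es" "layout (2 * w) \<H>o os"
    "set cs \<inter> set es = {}" "V - R = set cs \<union> set es" "V - R = set os"
    and Qa: "\<forall>Q. Q \<subseteq> V \<longrightarrow> clique Q \<longrightarrow> Q - R \<in> \<H>s \<or> Q \<in> \<H>e \<or> Q \<in> \<H>o"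
    and CU: "R \<subseteq> V"
    by (rule two_layoutsE[OF 1])
  obtain cs' \<H>s' es' \<H>e' os' \<H>o' where **:
    "layout w \<H>s' cs'" "layout (2 * w) \<H>e' es'" "layout (2 * w) \<H>o' os'"
    "set cs' \<inter> set es' = {}" "U - C = set cs' \<union> set es'" "U - C = set os'"
    and Q'a: "\<forall>Q. Q \<subseteq> U \<longrightarrow> clique Q \<longrightarrow> Q - C \<in> \<H>s' \<or> Q \<in> \<H>e' \<or> Q \<in> \<H>o'"
    and CU': "C \<subseteq> U"
    by (rule two_layoutsE[OF 2])
  have disj: "(V - R) \<inter> (U - C) = {}" using i by blast
  have disjs: "set cs \<inter> set cs' = {}" "set es \<inter> set es' = {}"
    "set cs \<inter> set es' = {}" "set es \<inter> set cs' = {}"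
    using disj unfolding *(5) **(5) by blast+
  have disjo: "set os \<inter> set os' = {}" using disj unfolding *(6) **(6) .
  note layouts = layout_append[OF *(1) **(1) disjs(1)] layout_append[OF *(2) **(2) disjs(2)]
    layout_append[OF *(3) **(3) disjo]
  have cs_es: "set (cs @ cs') \<inter> set (es @ es') = {}" using disjs *(4) **(4) by auto
  have VU: "V \<union> U - (R \<union> C) = (V - R) \<union> (U - C)" using i CU CU' by blast
  have sets: "V \<union> U - (R \<union> C) = set (cs @ cs') \<union> set (es @ es')"
    unfolding VU *(5) **(5) by auto
  have sets': "V \<union> U - (R \<union> C) = set (os @ os')"
    unfolding VU *(6) **(6) by simp
  have Q: "Q - (R \<union> C) \<in> \<H>s \<union> \<H>s' \<or> Q \<in> \<H>e \<union> \<H>e' \<or> Q \<in> \<H>o \<union> \<H>o'"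
    if q: "Q \<subseteq> V \<union> U" "clique Q" for Q
    using clique_Un_cases[OF q(2,1) n]
  proof
    assume "Q \<subseteq> V"
    moreover from this have "Q - (R \<union> C) = Q - R" using CU' i by blast
    ultimately show ?thesis using Qa[rule_format, OF \<open>Q \<subseteq> V\<close> q(2)] by auto
  next
    assume "Q \<subseteq> U"
    moreover from this have "Q - (R \<union> C) = Q - C" using CU i by blast
    ultimately show ?thesis using Q'a[rule_format, OF \<open>Q \<subseteq> U\<close> q(2)] by auto
  qed
  have "R \<union> C \<subseteq> V \<union> U" using CU CU' by blast
  from two_layoutsI[OF layouts this cs_es sets sets' Q] show ?thesis by simp
qed

lemma card_neighbours:
  assumes "finite S" "\<And>v. v \<in> S \<Longrightarrow> card {u \<in> V. E v u} \<le> d" "finite V"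
  shows "card {u \<in> V. \<exists>v\<in>S. E v u} \<le> d * card S"
proof -
  have "{u \<in> V. \<exists>v\<in>S. E v u} = (\<Union>v\<in>S. {u \<in> V. E v u})" by auto
  then have "card {u \<in> V. \<exists>v\<in>S. E v u} \<le> (\<Sum>v\<in>S. card {u \<in> V. E v u})"
    using card_UN_le[OF assms(1)] by simp
  also have "\<dots> \<le> d * card S" using sum_bounded_above[of S "\<lambda>v. card {u \<in> V. E v u}" d] assms(2)
    by (simp add: mult.commute)
  finally show ?thesis .
qed

lemma obtain_superset_card:
  assumes "finite V" "N \<subseteq> V" "m \<le> card V" "card N \<le> M" "m \<le> M"
  obtains N' where "N \<subseteq> N'" "N' \<subseteq> V" "m \<le> card N'" "card N' \<le> M"
proof (cases "m \<le> card N")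
  case True then show ?thesis using that assms by blast
next
  case False
  have fN: "finite N" using assms finite_subset by blast
  have "m - card N \<le> card (V - N)" using assms fN by (simp add: card_Diff_subset)
  then obtain D where D: "D \<subseteq> V - N" "card D = m - card N"
    by (metis obtain_subset_with_card_n)
  have "card (N \<union> D) = m" using D False fN finite_subset[OF _ assms(1), of D]
    by (subst card_Un_disjoint) auto
  then show ?thesis using that[of "N \<union> D"] D assms by auto
qed

text \<open>
  The slack \<open>4 K\<close> in the bound on the root bag pays for the separator, which is added to \<open>S\<close> on both
  sides when two tree-partitions are merged.
\<close>

lemma two_layouts_exist_aux:
  assumes "tree_bags K X \<B> V" "S \<subseteq> V" "4 * K \<le> card S" "card S \<le> 12 * K * d" "K \<ge> 1" "d \<ge> 1"
    "\<And>v. v \<in> V \<Longrightarrow> card {u \<in> V. E v u} \<le> d"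
  shows "\<exists>R. S \<subseteq> R \<and> R \<subseteq> V \<and> card R + 4 * K \<le> 2 * card S \<and> two_layouts (24 * K * d) R V"
  using assms
proof (induction "card V" arbitrary: X \<B> V S rule: less_induct)
  case less
  define w where "w = 24 * K * d"
  have fV: "finite V" using tree_bags_facts[OF less.prems(1)] by blast
  then have fS: "finite S" using less.prems finite_subset by blast
  have Kd: "K \<le> K * d" using less.prems by simp
  have deg: "card {u \<in> W. E v u} \<le> d" if "W \<subseteq> V" "v \<in> W" for v W
  proof -
    have "card {u \<in> W. E v u} \<le> card {u \<in> V. E v u}" using that fV by (intro card_mono) auto
    then show ?thesis using less.prems(7)[of v] that by fastforce
  qed
  have restr: "\<exists>X \<B>. tree_bags K X \<B> W" if "W \<subseteq> V" for W
    using tree_bags_restrict[OF less.prems(1), of W] that by (metis inf.absorb2)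
  have IH: thesis if h: "card W < card V" "W \<subseteq> V" "N \<subseteq> W" "4 * K \<le> card N" "card N \<le> 12 * K * d"
    "\<And>R. N \<subseteq> R \<Longrightarrow> R \<subseteq> W \<Longrightarrow> card R + 4 * K \<le> 2 * card N \<Longrightarrow> two_layouts w R W \<Longrightarrow> thesis" for W N thesis
  proof -
    obtain X' \<B>' where tb: "tree_bags K X' \<B>' W" using restr[OF h(2)] by (elim exE)
    have "\<exists>R. N \<subseteq> R \<and> R \<subseteq> W \<and> card R + 4 * K \<le> 2 * card N \<and> two_layouts w R W"
      unfolding w_def by (rule less.hyps[OF h(1) tb h(3-5) less.prems(5,6) deg[OF h(2)]])
    then show ?thesis using h(6) by blast
  qed
  \<comment> \<open>Either the rest fits into one leaf bag, or \<open>S\<close> is so small that it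
    has at most \<open>12 * K * d\<close> neighbours, or \<open>S\<close> is so large that each side
    of a balanced separator keeps more than \<open>4 * K\<close> of its vertices.\<close>
  consider "card (V - S) < 4 * K" | "4 * K \<le> card (V - S)" "card S \<le> 12 * K"
    | "12 * K < card S" by linarith
  then show ?case
  proof cases
    case 1
    have "two_layouts w S V" using 1 Kd less.prems fV
      by (intro two_layouts_base) (auto simp: w_def)
    then show ?thesis using less.prems unfolding w_def by (intro exI[of _ S]) auto
  next
    case 2
    let ?U = "V - S"
    let ?N = "{u \<in> ?U. \<exists>v\<in>S. E v u}"
    have "card {u \<in> V. \<exists>v\<in>S. E v u} \<le> d * card S"
      using card_neighbours[OF fS, of V d] less.prems fV by auto
    moreover have "card ?N \<le> card {u \<in> V. \<exists>v\<in>S. E v u}" using fV by (intro card_mono) auto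
    moreover have "d * card S \<le> 12 * K * d" using 2 mult_le_mono2[of "card S" "12 * K" d] by (simp add: mult_ac)
    ultimately have "card ?N \<le> 12 * K * d" by linarith
    \<comment> \<open>Padding to \<open>4 * K\<close> vertices restores the lower bound demanded by
      the induction hypothesis.\<close>
    then obtain N where N: "?N \<subseteq> N" "N \<subseteq> ?U" "4 * K \<le> card N" "card N \<le> 12 * K * d"
      using obtain_superset_card[of ?U ?N "4 * K" "12 * K * d"] 2 fV Kd by auto
    have "S \<noteq> {}" using less.prems by auto
    then have "card ?U < card V" using less.prems fV by (intro psubset_card_mono) auto
    then obtain R where R: "N \<subseteq> R" "R \<subseteq> ?U" "card R + 4 * K \<le> 2 * card N" "two_layouts w R ?U"
      using IH[of ?U N] N(2-4) by blast
    have "two_layouts w S (S \<union> ?U)"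
    proof (rule two_layouts_grow[OF R(4)])
      show "card R \<le> w" using R N by (simp add: w_def)
      show "no_edge S (?U - R)" using N R by (auto simp: no_edge_def)
    qed (use fV in auto)
    moreover have "S \<union> ?U = V" using less.prems by blast
    ultimately show ?thesis using less.prems unfolding w_def by (intro exI[of _ S]) auto
  next
    case 3
    have VS: "V \<inter> S = S" using less.prems by blast
    then obtain A Z where A: "Z \<subseteq> A" "A \<subseteq> V" "card Z \<le> K" "no_edge (A - Z) (V - A)"
      "card S \<le> 3 * card (A \<inter> S)" "3 * card (A \<inter> S) \<le> 2 * card S"
      using tree_bags_separator[OF less.prems(1) fS] 3 by auto
    \<comment> \<open>\<open>A\<close> and \<open>C\<close> overlap exactly in \<open>Z\<close>,
      which is therefore required in both root bags.\<close>
    define C where "C = (V - A) \<union> Z"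
    define S1 where "S1 = (A \<inter> S) \<union> Z"
    define S2 where "S2 = (C \<inter> S) \<union> Z"
    have "finite A" "finite Z" using A(1,2) fV by (auto intro: finite_subset)
    then have fin: "finite A" "finite Z" "finite C" "finite (A \<inter> S)" "finite S1" "finite S2"
      using fV by (auto simp: C_def S1_def S2_def)
    have split: "card S = card (A \<inter> S) + card (S - A)"
      using card_Un_disjoint[of "A \<inter> S" "S - A"] fS fin
      by (metis Diff_disjoint Int_Diff_Un Int_commute finite_Diff inf_assoc inf_bot_right)
    have S2eq: "S2 = (S - A) \<union> Z" unfolding S2_def C_def using less.prems A by blast
    have c1: "card S1 \<le> card (A \<inter> S) + K" unfolding S1_def using card_Un_le[of "A \<inter> S" Z] A by linarith
    have c2: "card S2 \<le> card (S - A) + K" unfolding S2eq using card_Un_le[of "S - A" Z] A by linarith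
    have l1: "card (A \<inter> S) \<le> card S1" unfolding S1_def using fin by (intro card_mono) (auto simp: S1_def)
    have l2: "card (S - A) \<le> card S2" using fin by (intro card_mono) (auto simp: S2eq)
    have CV: "C \<subseteq> V" unfolding C_def using A by blast
    \<comment> \<open>Both sides are proper: \<open>A\<close> misses a vertex of \<open>S\<close>,
      and \<open>C\<close> misses a vertex of \<open>A \<inter> S\<close>, which is larger than
      \<open>Z\<close>.\<close>
    have "card (S - A) > 0" using split A 3 by linarith
    then have "S - A \<noteq> {}" by (metis card.empty less_irrefl)
    then have "A \<subset> V" using A less.prems by blast
    then have A_lt: "card A < card V" using fV by (intro psubset_card_mono)
    have "card Z < card (A \<inter> S)" using A 3 by linarith
    then have "\<not> A \<inter> S \<subseteq> Z" using fin card_mono by (metis not_less)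
    then have "C \<subset> V" unfolding C_def using A by blast
    then have C_lt: "card C < card V" using fV by (intro psubset_card_mono)
    have "4 * K \<le> card S1" "card S1 \<le> 12 * K * d" "4 * K \<le> card S2" "card S2 \<le> 12 * K * d"
      using c1 c2 l1 l2 A 3 split less.prems by linarith+
    then have S12: "4 * K \<le> card S1" "card S1 \<le> 12 * K * d" "4 * K \<le> card S2" "card S2 \<le> 12 * K * d" .
    have sub: "S1 \<subseteq> A" "S2 \<subseteq> C" using A(1) unfolding S1_def S2_def C_def by auto
    obtain R1 where R1: "S1 \<subseteq> R1" "R1 \<subseteq> A" "card R1 + 4 * K \<le> 2 * card S1" "two_layouts w R1 A"
      by (rule IH[OF A_lt A(2) sub(1) S12(1,2)])
    obtain R2 where R2: "S2 \<subseteq> R2" "R2 \<subseteq> C" "card R2 + 4 * K \<le> 2 * card S2" "two_layouts w R2 C"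
      by (rule IH[OF C_lt CV sub(2) S12(3,4)])
    have "two_layouts w (R1 \<union> R2) (A \<union> C)"
    proof (rule two_layouts_merge[OF R1(4) R2(4)])
      show "A \<inter> C \<subseteq> R1 \<inter> R2" using R1 R2 unfolding C_def S1_def S2_def by blast
      show "no_edge (A - C) (C - A)" using A unfolding C_def no_edge_def by blast
    qed
    moreover have "A \<union> C = V" using A unfolding C_def by blast
    \<comment> \<open>The sizes of \<open>S1\<close> and \<open>S2\<close> add up to at most
      \<open>card S + 2 * K\<close>; doubled, this exceeds \<open>2 * card S\<close> by
      \<open>4 * K\<close>, while the two slacks give back \<open>8 * K\<close>.\<close>
    moreover have "card (R1 \<union> R2) + 4 * K \<le> 2 * card S"
      using card_Un_le[of R1 R2] R1 R2 c1 c2 split by linarith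
    moreover have "S \<subseteq> R1 \<union> R2" using R1 R2 unfolding S1_def S2eq by blast
    moreover have "R1 \<union> R2 \<subseteq> V" using R1 R2 A CV by blast
    ultimately show ?thesis unfolding w_def by (intro exI[of _ "R1 \<union> R2"]) auto
  qed
qed

lemma two_layouts_exist:
  assumes "tree_bags K X \<B> V" "K \<ge> 1" "d \<ge> 1" "\<And>v. v \<in> V \<Longrightarrow> card {u \<in> V. E v u} \<le> d"
  shows "\<exists>K1 \<H>1 K2 \<H>2. layout (48 * K * d) \<H>1 K1 \<and> layout (48 * K * d) \<H>2 K2 \<and> set K1 = V \<and> set K2 = V \<and>
    (\<forall>Q. Q \<subseteq> V \<longrightarrow> clique Q \<longrightarrow> Q \<in> \<H>1 \<or> Q \<in> \<H>2)"
proof -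
  define w where "w = 24 * K * d"
  have fV: "finite V" using tree_bags_facts[OF assms(1)] by blast
  have Kd: "K \<le> K * d" using assms by simp
  obtain R where R: "R \<subseteq> V" "card R \<le> w" "two_layouts w R V"
  proof (cases "card V \<le> 4 * K")
    case True
    then have "card V \<le> w" using Kd unfolding w_def mult.assoc by linarith
    moreover have "two_layouts w V V" using two_layouts_base[of V V w] fV by simp
    ultimately show ?thesis using that[of V] by simp
  next
    case False
    \<comment> \<open>Nothing is required of the root bag at the start, so any \<open>4 * K\<close>
      vertices serve.\<close>
    then obtain S where S: "S \<subseteq> V" "card S = 4 * K"
      by (metis nat_le_linear obtain_subset_with_card_n)
    have "4 * K \<le> card S" "card S \<le> 12 * K * d" using S(2) Kd unfolding mult.assoc by linarith+
    then have "\<exists>R. S \<subseteq> R \<and> R \<subseteq> V \<and> card R + 4 * K \<le> 2 * card S \<and> two_layouts w R V"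
      unfolding w_def using two_layouts_exist_aux[OF assms(1) S(1) _ _ assms(2-4)] by simp
    then obtain R where "R \<subseteq> V" "card R + 4 * K \<le> 2 * card S" "two_layouts w R V" by (elim exE conjE)
    moreover from this have "card R \<le> w" using S(2) Kd unfolding w_def mult.assoc by linarith
    ultimately show ?thesis using that by simp
  qed
  obtain cs \<H>s es \<H>e os \<H>o where *:
    "layout w \<H>s cs" "layout (2 * w) \<H>e es" "layout (2 * w) \<H>o os"
    "set cs \<inter> set es = {}" "V - R = set cs \<union> set es" "V - R = set os"
    and Q: "\<forall>Q. Q \<subseteq> V \<longrightarrow> clique Q \<longrightarrow> Q - R \<in> \<H>s \<or> Q \<in> \<H>e \<or> Q \<in> \<H>o"
    by (rule two_layoutsE[OF R(3)])
  obtain Rl where Rl: "set Rl = R" "distinct Rl"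
    using finite_distinct_list[of R] finite_subset[OF R(1) fV] by blast
  have len: "length Rl \<le> w" using Rl R distinct_card[of Rl] by simp
  let ?A = "{H. H \<subseteq> set Rl \<union> set cs \<and> H - set Rl \<in> \<H>s}"
  have disj: "set Rl \<inter> set cs = {}" "set Rl \<inter> set es = {}" using *(5) Rl(1) by auto
  have disjo: "set os \<inter> set Rl = {}" using *(6) Rl(1) by auto
  have 1: "layout (2 * w) (?A \<union> \<H>e) ((Rl @ cs) @ es)"
    by (rule layout_append[OF layout_star[OF Rl(2) len *(1) disj(1)] *(2)]) (use disj *(4) in auto)
  \<comment> \<open>\<open>R\<close> joins the second list only so that it enumerates all of
    \<open>V\<close>; no clique is charged to it there.\<close>
  have "layout (2 * w) {} Rl" using Rl len by (intro layout_small) auto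
  then have 2: "layout (2 * w) (\<H>o \<union> {}) (os @ Rl)" using *(3) disjo by (intro layout_append)
  have "V = R \<union> (set cs \<union> set es)" "V = set os \<union> R" using *(5,6) R(1) by blast+
  then have sets: "set ((Rl @ cs) @ es) = V" "set (os @ Rl) = V" using Rl(1) by auto
  have Q': "Q \<in> ?A \<union> \<H>e \<or> Q \<in> \<H>o \<union> {}" if "Q \<subseteq> V" "clique Q" for Q
  proof -
    have "Q \<in> ?A" if "Q - R \<in> \<H>s"
    proof -
      have "Q - R \<subseteq> set cs" using that *(1) by (auto simp: layout_def)
      then show ?thesis using that Rl(1) by auto
    qed
    then show ?thesis using Q[rule_format, OF that] by blast
  qed
  have "2 * w = 48 * K * d" by (simp add: w_def)
  show ?thesis unfolding \<open>2 * w = 48 * K * d\<close>[symmetric]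
    by (intro exI conjI) (rule 1, rule 2, rule sets, rule sets, use Q' in blast)
qed

end

section \<open>Tree decompositions by removal of leaves\<close>

definition connected_in :: "('t \<times> 't) set \<Rightarrow> 't set \<Rightarrow> bool" where
  "connected_in A N \<longleftrightarrow> (\<forall>x\<in>N. \<forall>y\<in>N. (x, y) \<in> (A \<inter> N \<times> N)\<^sup>*)"

definition acyclic_edges :: "('t \<times> 't) set \<Rightarrow> bool" where
  "acyclic_edges A \<longleftrightarrow> \<not> (\<exists>vs. 3 \<le> length vs \<and> distinct vs \<and>
     successively (\<lambda>x y. (x, y) \<in> A) vs \<and> (last vs, hd vs) \<in> A)"

lemma connected_in_neighbour:
  assumes "connected_in A N" "x \<in> N" "y \<in> N" "x \<noteq> y"
  obtains z where "(x, z) \<in> A" "z \<in> N"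
proof -
  have "(x, y) \<in> (A \<inter> N \<times> N)\<^sup>*" using assms(1-3) by (simp add: connected_in_def)
  then show ?thesis using assms(4) that by (cases rule: converse_rtranclE) auto
qed

text \<open>A walk enters and leaves the leaf \<open>t\<close> only through \<open>p\<close>, so a
  visit to \<open>t\<close> can be cut out. The induction invariant replaces a current position
  \<open>t\<close> by \<open>p\<close>.\<close>

lemma connected_in_remove_leaf:
  assumes "connected_in A N" "sym A" and leaf: "\<And>q. q \<in> N \<Longrightarrow> (q, t) \<in> A \<Longrightarrow> q = p" and "t \<noteq> p"
  shows "connected_in A (N - {t})"
  unfolding connected_in_def
proof (intro ballI)
  let ?R = "A \<inter> (N - {t}) \<times> (N - {t})"
  fix x y assume x: "x \<in> N - {t}" and y: "y \<in> N - {t}"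
  have "(x, y) \<in> (A \<inter> N \<times> N)\<^sup>*" using assms(1) x y by (simp add: connected_in_def)
  then have "(y \<noteq> t \<longrightarrow> (x, y) \<in> ?R\<^sup>*) \<and> (y = t \<longrightarrow> (x, p) \<in> ?R\<^sup>*)"
  proof (induction rule: rtrancl_induct)
    case base then show ?case using x by simp
  next
    case (step y z)
    consider "y \<noteq> t" "z \<noteq> t" | "y \<noteq> t" "z = t" | "y = t" by blast
    then show ?case
    proof cases
      case 1
      then have "(x, y) \<in> ?R\<^sup>*" "(y, z) \<in> ?R" using step by auto
      then show ?thesis using 1 by (meson rtrancl.rtrancl_into_rtrancl)
    next
      case 2
      then have "y = p" using leaf step(2) by auto
      then show ?thesis using 2 step.IH by auto
    next
      case 3
      then have "(z, t) \<in> A" "z \<in> N" using step(2) \<open>sym A\<close> by (auto dest: symD)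
      then have "z = p" using leaf by simp
      then show ?thesis using 3 step.IH assms(4) by auto
    qed
  qed
  then show "(x, y) \<in> ?R\<^sup>*" using y by simp
qed

text \<open>The leaf is the end of a longest path that starts in \<open>r\<close>.\<close>

lemma leaf_exists:
  assumes "finite N" "connected_in A N" "sym A" "acyclic_edges A" "irrefl A" "r \<in> N" "N \<noteq> {r}"
  obtains t p where "t \<in> N" "t \<noteq> r" "p \<in> N" "t \<noteq> p" "\<And>q. q \<in> N \<Longrightarrow> (q, t) \<in> A \<Longrightarrow> q = p"
proof -
  let ?E = "\<lambda>x y. (x, y) \<in> A"
  let ?P = "\<lambda>vs. vs \<noteq> [] \<and> distinct vs \<and> set vs \<subseteq> N \<and> successively ?E vs \<and> last vs = r"
  have "length vs \<le> card N" if "?P vs" for vs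
    using that card_mono[OF assms(1), of "set vs"] distinct_card[of vs] by simp
  moreover have "?P [r]" using assms(6) by simp
  ultimately obtain vs where vs: "?P vs" and max: "\<And>us. ?P us \<Longrightarrow> length us \<le> length vs"
    using ex_has_greatest_nat[of ?P "[r]" length "Suc (card N)"] le_imp_less_Suc by blast
  obtain r' where "r' \<in> N" "r \<noteq> r'" using assms(6,7) by blast
  then obtain z where z: "(r, z) \<in> A" "z \<in> N" using connected_in_neighbour assms(2,6) by metis
  then have "?P [z, r]" using assms(3,5,6) by (auto simp: irrefl_def dest: symD)
  then have len: "2 \<le> length vs" using max[of "[z, r]"] by simp
  then obtain t p ws where tp: "vs = t # p # ws"
    by (cases vs; cases "tl vs") auto
  have "q = p" if "q \<in> N" "(q, t) \<in> A" for q
  proof (rule ccontr)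
    assume "q \<noteq> p"
    have "q \<noteq> t" using that assms(5) by (auto simp: irrefl_def)
    \<comment> \<open>The path is listed from its far end \<open>t\<close> to \<open>r\<close>. A
      neighbour of \<open>t\<close> off the path would prolong it; one beyond \<open>p\<close>
      closes a cycle of length at least 3.\<close>
    have "q \<in> set vs"
    proof (rule ccontr)
      assume "q \<notin> set vs"
      then have "?P (q # vs)" using vs that tp by simp
      then show False using max[of "q # vs"] by simp
    qed
    then have "q \<in> set ws" using tp \<open>q \<noteq> p\<close> \<open>q \<noteq> t\<close> by simp
    then obtain us us' where ws: "ws = us @ q # us'" by (meson split_list)
    let ?c = "t # p # us @ [q]"
    have c: "vs = ?c @ us'" using tp ws by simp
    have "distinct (?c @ us')" "successively ?E (?c @ us')" using vs unfolding c by blast+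
    then have "distinct ?c" "successively ?E ?c"
      unfolding successively_append_iff distinct_append by blast+
    moreover have "(last ?c, hd ?c) \<in> A" using that by simp
    moreover have "3 \<le> length ?c" by simp
    ultimately show False using assms(4) unfolding acyclic_edges_def by blast
  qed
  moreover have "r = last (p # ws)" using vs tp by simp
  then have "r \<in> set (p # ws)" using last_in_set[of "p # ws"] by simp
  then have "t \<noteq> r" using vs tp by auto
  ultimately show ?thesis using that[of t p] vs tp by auto
qed

context sym_graph begin

text \<open>Remove a leaf \<open>t\<close> other than \<open>r\<close>, with neighbour
  \<open>p\<close>. Since the bags containing a given vertex are connected, a vertex of
  \<open>B t\<close> that occurs elsewhere occurs in \<open>B p\<close>, so \<open>B t\<close> can
  be attached there. Only edges between vertices of the bags must be covered, so this hypothesis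
  passes to \<open>N - {t}\<close>.\<close>

lemma tree_bags_of_tree:
  assumes A: "sym A" "acyclic_edges A" "irrefl A"
  assumes "finite N" "r \<in> N" "connected_in A N"
    and "\<And>t. t \<in> N \<Longrightarrow> finite (B t) \<and> card (B t) \<le> K"
    and "\<And>v. connected_in A {t \<in> N. v \<in> B t}"
    and "\<And>u v. u \<in> \<Union>(B ` N) \<Longrightarrow> v \<in> \<Union>(B ` N) \<Longrightarrow> E u v \<Longrightarrow> \<exists>t\<in>N. u \<in> B t \<and> v \<in> B t"
  shows "tree_bags K (B r) (B ` N) (\<Union>(B ` N))"
  using assms(4-)
proof (induction "card N" arbitrary: N rule: less_induct)
  case less
  show ?case
  proof (cases "N = {r}")
    case True
    then show ?thesis using tree_bags.single[of "B r" K] less.prems(4)[of r] by simp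
  next
    case False
    obtain t p where t: "t \<in> N" "t \<noteq> r" "p \<in> N" "t \<noteq> p"
      and leaf: "\<And>q. q \<in> N \<Longrightarrow> (q, t) \<in> A \<Longrightarrow> q = p"
      using leaf_exists[OF less.prems(1,3) A less.prems(2) False] by metis
    let ?M = "N - {t}"
    have attach: "v \<in> B p" if "v \<in> B t" "v \<in> B s" "s \<in> ?M" for v s
    proof -
      have "t \<in> {t \<in> N. v \<in> B t}" "s \<in> {t \<in> N. v \<in> B t}" "t \<noteq> s" using that t(1) by auto
      then obtain z where "(t, z) \<in> A" "z \<in> {t \<in> N. v \<in> B t}"
        by (rule connected_in_neighbour[OF less.prems(5)])
      then show ?thesis using leaf[of z] A(1) by (auto dest: symD)
    qed
    have "tree_bags K (B r) (B ` ?M) (\<Union>(B ` ?M))"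
    proof (rule less.hyps)
      show "card ?M < card N" using t(1) less.prems(1) by (rule card_Diff1_less[rotated])
      show "finite ?M" "r \<in> ?M" using less.prems(1,2) t(2) by auto
      show "connected_in A ?M"
        using connected_in_remove_leaf[OF less.prems(3) A(1) leaf t(4)] by simp
      show "finite (B s) \<and> card (B s) \<le> K" if "s \<in> ?M" for s using less.prems(4) that by simp
      show "connected_in A {s \<in> ?M. v \<in> B s}" for v
      proof -
        have "{s \<in> ?M. v \<in> B s} = {s \<in> N. v \<in> B s} - {t}" by auto
        moreover have "connected_in A ({s \<in> N. v \<in> B s} - {t})"
        proof (rule connected_in_remove_leaf[OF less.prems(5) A(1) _ t(4)])
          fix q assume "q \<in> {s \<in> N. v \<in> B s}" "(q, t) \<in> A"
          then show "q = p" using leaf[of q] by simp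
        qed
        ultimately show ?thesis by simp
      qed
      show "\<exists>s\<in>?M. u \<in> B s \<and> v \<in> B s" if "u \<in> \<Union>(B ` ?M)" "v \<in> \<Union>(B ` ?M)" "E u v" for u v
      proof -
        have "u \<in> \<Union>(B ` N)" "v \<in> \<Union>(B ` N)" using that by auto
        then have "\<exists>s\<in>N. u \<in> B s \<and> v \<in> B s" by (rule less.prems(6)[OF _ _ \<open>E u v\<close>])
        then obtain s where s: "s \<in> N" "u \<in> B s" "v \<in> B s" by blast
        show ?thesis
        proof (cases "s = t")
          case True
          then have "u \<in> B p" "v \<in> B p" using attach s that(1,2) by auto
          then show ?thesis using t(3,4) by (intro bexI[of _ p]) auto
        next
          case False
          then show ?thesis using s by (intro bexI[of _ s]) auto
        qed
      qed
    qed
    then have "tree_bags K (B r) (insert (B t) (B ` ?M)) (\<Union>(B ` ?M) \<union> B t)"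
    proof (rule tree_bags_add_leaf[where Y = "B p"])
      show "B p \<in> B ` ?M" using t by blast
      show "finite (B t)" "card (B t) \<le> K" using less.prems(4) t(1) by auto
      show "B t \<inter> \<Union>(B ` ?M) \<subseteq> B p" using attach by auto
      show "no_edge (B t - \<Union>(B ` ?M)) (\<Union>(B ` ?M) - B t)"
        unfolding no_edge_def
      proof (intro ballI notI)
        fix u v assume uv: "u \<in> B t - \<Union>(B ` ?M)" "v \<in> \<Union>(B ` ?M) - B t" "E u v"
        then have "u \<in> \<Union>(B ` N)" "v \<in> \<Union>(B ` N)" using t(1) by auto
        then have "\<exists>s\<in>N. u \<in> B s \<and> v \<in> B s" by (rule less.prems(6)[OF _ _ uv(3)])
        then obtain s where "s \<in> N" "u \<in> B s" "v \<in> B s" by blast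
        then show False using uv(1,2) by (cases "s = t") auto
      qed
    qed
    moreover have "B ` N = insert (B t) (B ` ?M)" using t(1) by blast
    ultimately show ?thesis by (simp add: Un_commute)
  qed
qed

end

section \<open>From digraph trees and treewidth to \<open>tree_bags\<close>\<close>

lemma undirected_tree_facts:
  assumes "undirected_tree T"
  shows "sym (parcs T)" "irrefl (parcs T)" "acyclic_edges (parcs T)" "finite (pverts T)"
    "connected_in (parcs T) (pverts T)" "pverts T \<noteq> {}"
proof -
  interpret pair_graph T using assms by (simp add: undirected_tree_def)
  have con: "Digraph_Component.connected (with_proj T)" using assms by (simp add: undirected_tree_def)
  show s: "sym (parcs T)" using pair_sym_arcs by (auto simp: symmetric_def arcs_ends_def arc_to_ends_def sym_def)
  show "irrefl (parcs T)" using pair_no_loops by (fastforce simp: irrefl_def)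
  show "finite (pverts T)" by simp
  show "pverts T \<noteq> {}" using con by (simp add: Digraph_Component.connected_def strongly_connected_def mk_symmetric_def)
  have "connected_in (parcs T) (pverts T)"
    unfolding connected_in_def
  proof (intro ballI)
    fix x y assume "x \<in> pverts T" "y \<in> pverts T"
    then have "x \<rightarrow>\<^sup>*\<^bsub>with_proj (mk_symmetric T)\<^esub> y"
      using con by (simp add: Digraph_Component.connected_def strongly_connected_def mk_symmetric_def)
    then have "(x, y) \<in> (arcs_ends (with_proj (mk_symmetric T)))\<^sup>*"
      unfolding reachable_def by (rule rtrancl_on_rtranclI)
    moreover have "arcs_ends (with_proj (mk_symmetric T)) \<subseteq> parcs T \<inter> pverts T \<times> pverts T"
      using s wellformed' by (auto simp: arcs_ends_def arc_to_ends_def mk_symmetric_def dest: symD)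
    ultimately show "(x, y) \<in> (parcs T \<inter> pverts T \<times> pverts T)\<^sup>*"
      using rtrancl_mono by blast
  qed
  then show "connected_in (parcs T) (pverts T)" .
  show "acyclic_edges (parcs T)"
    unfolding acyclic_edges_def
  proof (intro notI, elim exE conjE)
    fix vs assume vs: "3 \<le> length vs" "distinct vs" "successively (\<lambda>x y. (x, y) \<in> parcs T) vs"
      "(last vs, hd vs) \<in> parcs T"
    \<comment> \<open>A vertex sequence becomes the arc list \<open>zip us (tl us)\<close>; closing
      \<open>vs\<close> with its head gives a digraph cycle with as many arcs as \<open>vs\<close>
      has vertices.\<close>
    have walk: "cas (hd us) (zip us (tl us)) (last us) \<and> awalk_verts (hd us) (zip us (tl us)) = us
        \<and> set (zip us (tl us)) \<subseteq> parcs T"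
      if "successively (\<lambda>x y. (x, y) \<in> parcs T) us" "us \<noteq> []" for us
      using that
    proof (induction us)
      case (Cons a us) then show ?case by (cases us) auto
    qed simp
    define us where "us = vs @ [hd vs]"
    have ne: "vs \<noteq> []" using vs by auto
    have w: "successively (\<lambda>x y. (x, y) \<in> parcs T) us" "us \<noteq> []"
      using vs ne by (auto simp: us_def successively_append_iff)
    have "hd us = hd vs" "last us = hd vs" "tl us = tl vs @ [hd vs]" using ne by (auto simp: us_def)
    moreover have "hd vs \<in> pverts T" using vs(4) wellformed' by blast
    moreover have "distinct (tl vs @ [hd vs])" using vs(2) ne by (cases vs) auto
    moreover have "zip us (tl us) \<noteq> []" using ne by (cases vs) (auto simp: us_def)
    ultimately have "cycle (zip us (tl us))"
      using walk[OF w] unfolding cycle_def awalk_def by auto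
    moreover have "3 \<le> length (zip us (tl us))" using vs(1) by (simp add: us_def)
    ultimately show False using assms unfolding undirected_tree_def by blast
  qed
qed

lemma connected_in_induce_subgraph:
  assumes "Digraph_Component.connected (induce_subgraph (with_proj T) W)" "sym (parcs T)"
  shows "connected_in (parcs T) W"
  unfolding connected_in_def
proof (intro ballI)
  let ?S = "with_proj (mk_symmetric (induce_subgraph (with_proj T) W))"
  fix x y assume "x \<in> W" "y \<in> W"
  then have "x \<rightarrow>\<^sup>*\<^bsub>?S\<^esub> y"
    using assms(1) by (simp add: Digraph_Component.connected_def strongly_connected_def mk_symmetric_def)
  then have "(x, y) \<in> (arcs_ends ?S)\<^sup>*"
    unfolding reachable_def by (rule rtrancl_on_rtranclI)
  moreover have "arcs_ends ?S \<subseteq> parcs T \<inter> W \<times> W"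
    using assms(2) by (auto simp: arcs_ends_def arc_to_ends_def mk_symmetric_def dest: symD)
  ultimately show "(x, y) \<in> (parcs T \<inter> W \<times> W)\<^sup>*"
    using rtrancl_mono by blast
qed

lemma tree_decomposition_tree_bags:
  assumes td: "tree_decomposition G T B" and fin: "finite (pverts G)"
    and "sym (parcs G)"
  shows "\<exists>X \<B>. sym_graph.tree_bags (\<lambda>u v. (u, v) \<in> parcs G) (decomposition_width T B + 1) X \<B> (pverts G)"
proof -
  interpret sym_graph "\<lambda>u v. (u, v) \<in> parcs G"
    using assms(3) by unfold_locales (auto dest: symD)
  have ut: "undirected_tree T" and V: "\<Union>(B ` pverts T) = pverts G"
    and edges: "\<And>u v. (u, v) \<in> parcs G \<Longrightarrow> \<exists>t\<in>pverts T. u \<in> B t \<and> v \<in> B t"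
    and con: "\<And>v. v \<in> pverts G \<Longrightarrow> Digraph_Component.connected
        (induce_subgraph (with_proj T) {t \<in> pverts T. v \<in> B t})"
    using td by (auto simp: tree_decomposition_def)
  note T = undirected_tree_facts[OF ut]
  obtain r where "r \<in> pverts T" using T(6) by blast
  have "tree_bags (decomposition_width T B + 1) (B r) (B ` pverts T) (\<Union>(B ` pverts T))"
  proof (rule tree_bags_of_tree[OF T(1,3,2,4) \<open>r \<in> pverts T\<close> T(5)])
    show "finite (B t) \<and> card (B t) \<le> decomposition_width T B + 1" if "t \<in> pverts T" for t
    proof
      show "finite (B t)" using that V fin by (metis UN_upper finite_subset)
      have "card (B t) \<le> Max ((\<lambda>t. card (B t)) ` pverts T)" using that T(4) by simp
      \<comment> \<open>With truncated subtraction \<open>Max - 1 + 1\<close> is still at least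
        \<open>Max\<close>, even if all bags are empty.\<close>
      then show "card (B t) \<le> decomposition_width T B + 1" by (simp add: decomposition_width_def)
    qed
    show "connected_in (parcs T) {t \<in> pverts T. v \<in> B t}" for v
    proof (cases "v \<in> pverts G")
      case True
      then show ?thesis using connected_in_induce_subgraph[OF con T(1)] by blast
    next
      case False
      then have none: "{t \<in> pverts T. v \<in> B t} = {}" using V by blast
      show ?thesis unfolding none by (simp add: connected_in_def)
    qed
  qed (use edges in blast)
  then show ?thesis using V by auto
qed

text \<open>The trivial decomposition guarantees that the minimum in \<open>treewidth\<close> is
  attained.\<close>

lemma tree_decomposition_single:
  assumes "parcs G \<subseteq> pverts G \<times> pverts G"
  shows   "tree_decomposition G \<lparr> pverts = {t}, parcs = {} \<rparr> (\<lambda>_. pverts G)"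
proof -
  let ?T = "\<lparr> pverts = {t}, parcs = {} \<rparr>"
  have con: "Digraph_Component.connected G" if "verts G = {t}" "arcs G = {}" for G :: "('b, 'b \<times> 'b) pre_digraph"
    using that by (auto simp: Digraph_Component.connected_def strongly_connected_def mk_symmetric_def
        reachable_def intro: rtrancl_on_refl)
  have "pair_graph ?T" by unfold_locales (auto simp: symmetric_def arcs_ends_def sym_def)
  moreover have "\<not> pre_digraph.cycle (with_proj ?T) p" for p
    by (auto simp: pre_digraph.cycle_def pre_digraph.awalk_def)
  ultimately have "undirected_tree ?T" using con[of "with_proj ?T"] by (simp add: undirected_tree_def)
  moreover have "Digraph_Component.connected (induce_subgraph (with_proj ?T) {t})" by (rule con) auto
  ultimately show ?thesis using assms by (auto simp: tree_decomposition_def)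
qed

lemma treewidth_tree_bags:
  assumes "finite (pverts G)" "sym (parcs G)" "parcs G \<subseteq> pverts G \<times> pverts G"
  shows "\<exists>X \<B>. sym_graph.tree_bags (\<lambda>u v. (u, v) \<in> parcs G) (treewidth G + 1) X \<B> (pverts G)"
proof -
  have "\<exists>w (T :: nat pair_pre_digraph) B. tree_decomposition G T B \<and> decomposition_width T B = w"
    by (intro exI conjI) (rule tree_decomposition_single[OF assms(3), of 0], rule refl)
  then have "\<exists>(T :: nat pair_pre_digraph) B. tree_decomposition G T B \<and> decomposition_width T B = treewidth G"
    unfolding treewidth_def by (rule LeastI_ex)
  then show ?thesis using tree_decomposition_tree_bags[OF _ assms(1,2)] by metis
qed

section \<open>OBDDs from layouts\<close>

text \<open>The arcs leaving the node \<open>u\<close> are \<open>2 u\<close> (negative literal) and \<open>2 u + 1\<close> (positive literal).\<close>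

definition layered_obdd ::
    "'v list \<Rightarrow> nat set \<Rightarrow> (nat \<Rightarrow> nat) \<Rightarrow> (nat \<Rightarrow> bool \<Rightarrow> nat) \<Rightarrow> nat \<Rightarrow> nat \<Rightarrow> (nat, nat, 'v) obdd" where
  "layered_obdd L N lev \<delta> t f =
    \<lparr> dag = \<lparr> verts = N \<union> {t, f}, arcs = {e. e div 2 \<in> N}, tail = \<lambda>e. e div 2, head = \<lambda>e. \<delta> (e div 2) (odd e) \<rparr>,
      lab = \<lambda>e. (if odd e then Pos else Neg) (L ! lev (e div 2)), true_sink = t, false_sink = f \<rparr>"

text \<open>The assumptions anticipate \<open>is_obdd\<close>: \<open>reached\<close> makes
  \<open>r\<close> the only source, \<open>step_lev\<close> gives acyclicity and the variable order,
  and \<open>lev_surj\<close> makes every entry of \<open>L\<close> label an arc. A sink may be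
  entered from any level.\<close>

locale layered =
  fixes L :: "'v list" and N :: "nat set" and lev :: "nat \<Rightarrow> nat" and \<delta> :: "nat \<Rightarrow> bool \<Rightarrow> nat"
    and r t f :: nat
  assumes L: "distinct L"
    and finite_N: "finite N"
    and sinks: "t \<notin> N" "f \<notin> N" "t \<noteq> f"
    and lev_less: "u \<in> N \<Longrightarrow> lev u < length L"
    and lev_surj: "i < length L \<Longrightarrow> \<exists>u\<in>N. lev u = i"
    and step: "u \<in> N \<Longrightarrow> \<delta> u c \<in> N \<union> {t, f}"
    and step_lev: "u \<in> N \<Longrightarrow> \<delta> u c \<in> N \<Longrightarrow> lev (\<delta> u c) = Suc (lev u)"
    and root: "r \<in> N" "lev r = 0"
    and reached: "v \<in> N \<union> {t, f} \<Longrightarrow> v \<noteq> r \<Longrightarrow> \<exists>u\<in>N. \<exists>c. \<delta> u c = v"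
begin

abbreviation "Z \<equiv> layered_obdd L N lev \<delta> t f"

lemma Z_sel [simp]:
  "verts (dag Z) = N \<union> {t, f}" "arcs (dag Z) = {e. e div 2 \<in> N}" "tail (dag Z) e = e div 2"
  "head (dag Z) e = \<delta> (e div 2) (odd e)"
  "lab Z e = (if odd e then Pos else Neg) (L ! lev (e div 2))" "true_sink Z = t" "false_sink Z = f"
  by (simp_all add: layered_obdd_def)

lemma lit_var_lab [simp]: "lit_var (lab Z e) = L ! lev (e div 2)"
  by simp

sublocale fin: fin_digraph "dag Z"
proof
  have "{e. e div 2 \<in> N} \<subseteq> (\<lambda>u. 2 * u) ` N \<union> (\<lambda>u. 2 * u + 1) ` N"
  proof
    fix e :: nat assume "e \<in> {e. e div 2 \<in> N}"
    moreover have "e = 2 * (e div 2) \<or> e = 2 * (e div 2) + 1" by presburger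
    ultimately show "e \<in> (\<lambda>u. 2 * u) ` N \<union> (\<lambda>u. 2 * u + 1) ` N" by blast
  qed
  then show "finite (arcs (dag Z))" using finite_N by (auto intro: finite_subset)
qed (use finite_N step in auto)

text \<open>Sinks get the level \<open>length L\<close>, so that \<open>lev'\<close> strictly
  increases along every arc, also along one that jumps to a sink early.\<close>

definition lev' :: "nat \<Rightarrow> nat" where
  "lev' v = (if v \<in> N then lev v else length L)"

lemma walk_levels:
  assumes "fin.cas u p v" "set p \<subseteq> arcs (dag Z)"
  shows "sorted_wrt (<) (map (\<lambda>e. lev (e div 2)) p) \<and>
    (\<forall>e\<in>set p. lev' u \<le> lev (e div 2) \<and> lev (e div 2) < lev' v \<and> lev (e div 2) < length L) \<and> lev' u \<le> lev' v"
  using assms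
proof (induction p arbitrary: u)
  case Nil then show ?case by simp
next
  case (Cons e p)
  have u: "u = e div 2" "u \<in> N" using Cons.prems by auto
  have "lev' (head (dag Z) e) > lev u"
    using u step_lev[of u "odd e"] lev_less by (auto simp: lev'_def)
  moreover have "lev' u = lev u" using u by (simp add: lev'_def)
  moreover have "lev u < length L" using u lev_less by simp
  moreover have IH: "sorted_wrt (<) (map (\<lambda>e. lev (e div 2)) p) \<and>
    (\<forall>e'\<in>set p. lev' (head (dag Z) e) \<le> lev (e' div 2) \<and> lev (e' div 2) < lev' v \<and> lev (e' div 2) < length L) \<and> lev' (head (dag Z) e) \<le> lev' v"
    using Cons.prems by (intro Cons.IH) auto
  ultimately show ?case using u(1) by fastforce
qed

lemma obdd_vars_Z: "obdd_vars Z = set L"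
proof -
  have "obdd_vars Z = (\<lambda>e. L ! lev (e div 2)) ` {e. e div 2 \<in> N}"
    unfolding obdd_vars_def image_image lit_var_lab by simp
  also have "\<dots> = (!) L ` lev ` (\<lambda>e. e div 2) ` {e. e div 2 \<in> N}"
    by (simp only: image_image)
  also have "(\<lambda>e. e div 2) ` {e :: nat. e div 2 \<in> N} = N"
  proof (intro set_eqI iffI)
    fix u assume "u \<in> N"
    then show "u \<in> (\<lambda>e. e div 2) ` {e. e div 2 \<in> N}" by (intro image_eqI[of _ _ "2 * u"]) auto
  qed auto
  also have "lev ` N = {0..<length L}"
  proof (intro set_eqI iffI)
    fix i assume "i \<in> {0..<length L}"
    then show "i \<in> lev ` N" using lev_surj[of i] by auto
  qed (use lev_less in auto)
  also have "(!) L ` {0..<length L} = set L" by (auto simp: set_conv_nth)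
  finally show ?thesis .
qed

lemma is_source_iff: "is_source (dag Z) v \<longleftrightarrow> v = r"
proof
  assume v: "is_source (dag Z) v"
  show "v = r"
  proof (rule ccontr)
    assume "v \<noteq> r"
    moreover have "v \<in> N \<union> {t, f}" using v by (auto simp: is_source_def)
    ultimately obtain u c where u: "u \<in> N" "\<delta> u c = v" using reached by blast
    then have "2 * u + of_bool c \<in> in_arcs (dag Z) v" by (cases c) (auto simp: in_arcs_def)
    then show False using v unfolding is_source_def by blast
  qed
next
  assume "v = r"
  moreover have "\<delta> u c \<noteq> r" if "u \<in> N" for u c using step_lev[OF that, of c] root by auto
  ultimately show "is_source (dag Z) v" using root by (auto simp: is_source_def in_arcs_def)
qed

lemma out_arcs_inner: "u \<in> N \<Longrightarrow> out_arcs (dag Z) u = {2 * u, 2 * u + 1}"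
  by (auto simp: out_arcs_def)

lemma is_sink_iff: "is_sink (dag Z) v \<longleftrightarrow> v = t \<or> v = f"
  using sinks out_arcs_inner by (fastforce simp: is_sink_def out_arcs_def)

lemma is_obdd_Z: "is_obdd Z"
  unfolding is_obdd_def
proof (intro conjI ballI allI impI)
  have walk: "sorted_wrt (<) (map (\<lambda>e. lev (e div 2)) p)"
    "e \<in> set p \<Longrightarrow> lev' u \<le> lev (e div 2) \<and> lev (e div 2) < lev' v \<and> lev (e div 2) < length L"
    if "fin.awalk u p v" for u p v e
    using walk_levels[of u p v] that by (auto simp: fin.awalk_def)
  show "fin_digraph (dag Z)" by unfold_locales
  show "\<nexists>p. fin.cycle p"
  proof
    assume "\<exists>p. fin.cycle p"
    then obtain p u where p: "fin.awalk u p u" "p \<noteq> []" by (auto simp: fin.cycle_def)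
    then have "hd p \<in> set p" by simp
    then show False using walk(2)[OF p(1)] by fastforce
  qed
  show "\<exists>!s. is_source (dag Z) s" by (simp add: is_source_iff)
  show "{v. is_sink (dag Z) v} = {true_sink Z, false_sink Z}" by (auto simp: is_sink_iff)
  show "true_sink Z \<noteq> false_sink Z" using sinks by simp
  show "\<exists>e1 e2. e1 \<noteq> e2 \<and> out_arcs (dag Z) v = {e1, e2} \<and> lab Z e2 = lit_neg (lab Z e1)"
    if "v \<in> verts (dag Z)" "\<not> is_sink (dag Z) v" for v
  proof -
    have "v \<in> N" using that by (auto simp: is_sink_iff)
    then show ?thesis
      by (intro exI[of _ "2 * v"] exI[of _ "2 * v + 1"]) (simp add: out_arcs_inner)
  qed
  have labs: "map (lit_var \<circ> lab Z) p = map (\<lambda>i. L ! i) (map (\<lambda>e. lev (e div 2)) p)" for p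
    by simp
  show "distinct (map (lit_var \<circ> lab Z) p)" if p: "fin.awalk u p v" for u p v
  proof -
    have "distinct (map (\<lambda>e. lev (e div 2)) p)" using walk(1)[OF p] strict_sorted_iff by blast
    moreover have "inj_on ((!) L) (set (map (\<lambda>e. lev (e div 2)) p))"
      using walk(2)[OF p] by (intro inj_on_nth[OF L]) auto
    ultimately show ?thesis unfolding labs by (simp only: distinct_map[of "(!) L"])
  qed
  let ?\<pi> = "{(L ! i, L ! j) | i j. i \<le> j \<and> j < length L}"
  have "linear_order_on (obdd_vars Z) ?\<pi>"
    unfolding obdd_vars_Z linear_order_on_def partial_order_on_def preorder_on_def
  proof (intro conjI)
    show "refl_on (set L) ?\<pi>"
      unfolding refl_on_def by (auto simp: in_set_conv_nth) (metis le_refl)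
    show "?\<pi> \<subseteq> set L \<times> set L" by auto
    show "trans ?\<pi>"
      unfolding trans_def using L by (auto simp: nth_eq_iff_index_eq) (metis le_trans nth_eq_iff_index_eq le_less_trans)
    show "antisym ?\<pi>"
      unfolding antisym_def using L by (auto simp: nth_eq_iff_index_eq) 
    show "total_on (set L) ?\<pi>"
      unfolding total_on_def by (auto simp: in_set_conv_nth) (metis nat_le_linear)
  qed
  moreover have "sorted_wrt (\<lambda>x y. (x, y) \<in> ?\<pi>) (map (lit_var \<circ> lab Z) p)" if p: "fin.awalk u p v" for u p v
  proof -
    have "sorted_wrt (\<lambda>i j. i < j \<and> j < length L) (map (\<lambda>e. lev (e div 2)) p)"
      using walk[OF p] by (auto simp: sorted_wrt_map intro: sorted_wrt_mono_rel[rotated])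
    then show ?thesis unfolding labs sorted_wrt_map[of _ "(!) L"]
      by (rule sorted_wrt_mono_rel[rotated]) (auto intro: less_imp_le)
  qed
  ultimately show "\<exists>\<pi>. linear_order_on (obdd_vars Z) \<pi> \<and>
      (\<forall>u p v. fin.awalk u p v \<longrightarrow> sorted_wrt (\<lambda>x y. (x, y) \<in> \<pi>) (map (lit_var \<circ> lab Z) p))"
    by blast
qed

text \<open>\<open>sem\<close> may be any predicate that is right at the sinks and invariant under
  the step chosen by \<open>S\<close>. These steps form the only walk consistent with
  \<open>S\<close>, and it ends in a sink because the levels increase; so \<open>sem\<close> must be
  acceptance of \<open>S\<close>.\<close>

lemma consistent_walk_iff:
  assumes S: "S \<in> assignments (set L)"
    and sem: "sem t" "\<not> sem f" "\<And>u. u \<in> N \<Longrightarrow> sem (\<delta> u (Pos (L ! lev u) \<in> S)) \<longleftrightarrow> sem u"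
    and v: "v \<in> N \<union> {t, f}"
  shows "(\<exists>p. fin.awalk v p t \<and> lab Z ` set p \<subseteq> S) \<longleftrightarrow> sem v"
proof
  have lab: "lab Z e \<in> S \<longleftrightarrow> (odd e \<longleftrightarrow> Pos (L ! lev (e div 2)) \<in> S)" if "e div 2 \<in> N" for e
    using S lev_less[OF that] by (auto simp: assignments_def)
  have "sem v" if "fin.cas v p t" "set p \<subseteq> arcs (dag Z)" "lab Z ` set p \<subseteq> S" for p
    using that
  proof (induction p arbitrary: v)
    case Nil then show ?case using sem by simp
  next
    case (Cons e p)
    then have e: "v = e div 2" "e div 2 \<in> N" "lab Z e \<in> S" by auto
    then have "odd e \<longleftrightarrow> Pos (L ! lev v) \<in> S" using lab by simp
    moreover have "sem (head (dag Z) e)" using Cons.prems by (intro Cons.IH) auto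
    ultimately show ?case using sem(3)[of v] e by simp
  qed
  then show "sem v" if "\<exists>p. fin.awalk v p t \<and> lab Z ` set p \<subseteq> S"
    using that by (auto simp: fin.awalk_def)
  show "\<exists>p. fin.awalk v p t \<and> lab Z ` set p \<subseteq> S" if "sem v"
    using that v
  proof (induction "length L - lev' v" arbitrary: v rule: less_induct)
    case less
    show ?case
    proof (cases "v \<in> N")
      case False
      then have "v = t" using less.prems sem(2) by blast
      then show ?thesis by (intro exI[of _ "[]"]) (simp add: fin.awalk_def)
    next
      case True
      define c where "c \<longleftrightarrow> Pos (L ! lev v) \<in> S"
      define e where "e = 2 * v + of_bool c"
      have e: "e div 2 = v" "odd e = c" by (cases c; simp add: e_def)+
      have "lev' (\<delta> v c) > lev' v"
        using step_lev[OF True, of c] lev_less[OF True] True by (auto simp: lev'_def)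
      moreover have "lev' v < length L" using lev_less[OF True] True by (simp add: lev'_def)
      ultimately have "length L - lev' (\<delta> v c) < length L - lev' v" by simp
      then obtain p where p: "fin.awalk (\<delta> v c) p t" "lab Z ` set p \<subseteq> S"
        using less.hyps[of "\<delta> v c"] sem(3)[OF True] less.prems(1) step[OF True, of c] unfolding c_def by blast
      have "fin.awalk v (e # p) t" using p(1) e True by (auto simp: fin.awalk_def)
      moreover have "lab Z e \<in> S" using lab[of e] e True c_def by simp
      ultimately show ?thesis using p(2) by (intro exI[of _ "e # p"]) auto
    qed
  qed
qed

lemma obdd_models_Z:
  assumes "\<And>S. S \<in> assignments (set L) \<Longrightarrow> sem S t \<and> \<not> sem S f"
    and "\<And>S u. S \<in> assignments (set L) \<Longrightarrow> u \<in> N \<Longrightarrow> sem S (\<delta> u (Pos (L ! lev u) \<in> S)) \<longleftrightarrow> sem S u"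
  shows "obdd_models Z = {S \<in> assignments (set L). sem S r}"
proof -
  have "(\<exists>s p. is_source (dag Z) s \<and> fin.awalk s p t \<and> lab Z ` set p \<subseteq> S) \<longleftrightarrow> sem S r"
    if "S \<in> assignments (set L)" for S
    using consistent_walk_iff[OF that, of "sem S" r] assms that root(1) by (simp add: is_source_iff)
  then show ?thesis unfolding obdd_models_def obdd_vars_Z by auto
qed

lemma obdd_size_Z: "obdd_size Z = card N + 2"
  using sinks finite_N by (simp add: obdd_size_def card_insert_if)

end

section \<open>The OBDD that reads a CNF along a layout\<close>

definition satisfies :: "'v set \<Rightarrow> 'v clause \<Rightarrow> bool" where
  "satisfies a C \<longleftrightarrow> (\<exists>l\<in>C. case l of Pos x \<Rightarrow> x \<in> a | Neg x \<Rightarrow> x \<notin> a)"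

text \<open>Sets of true variables, unlike members of \<open>assignments X\<close>, carry no domain.
  Partial assignments can therefore be cut and joined freely, and this lemma is the only control
  required.\<close>

lemma satisfies_cong:
  assumes "\<And>x. x \<in> clause_vars C \<Longrightarrow> x \<in> a \<longleftrightarrow> x \<in> b"
  shows "satisfies a C \<longleftrightarrow> satisfies b C"
proof -
  have "(case l of Pos x \<Rightarrow> x \<in> a | Neg x \<Rightarrow> x \<notin> a) = (case l of Pos x \<Rightarrow> x \<in> b | Neg x \<Rightarrow> x \<notin> b)"
    if "l \<in> C" for l
  proof -
    have "lit_var l \<in> clause_vars C" using that by (simp add: clause_vars_def)
    then show ?thesis using assms by (cases l) auto
  qed
  then show ?thesis unfolding satisfies_def by auto
qed

lemma satisfies_assignment:
  assumes "S \<in> assignments X" "clause_vars C \<subseteq> X"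
  shows "satisfies {x. Pos x \<in> S} C \<longleftrightarrow> C \<inter> S \<noteq> {}"
proof -
  have "(case l of Pos x \<Rightarrow> x \<in> {x. Pos x \<in> S} | Neg x \<Rightarrow> x \<notin> {x. Pos x \<in> S}) \<longleftrightarrow> l \<in> S" if "l \<in> C" for l
  proof -
    have "lit_var l \<in> X" using that assms(2) by (auto simp: clause_vars_def)
    then show ?thesis using assms(1) by (cases l) (auto simp: assignments_def)
  qed
  then show ?thesis unfolding satisfies_def by blast
qed

text \<open>\<open>satisfiable\<close> provides nodes on every level and an arc into the true sink;
  \<open>falsified\<close> provides an arc into the false sink and a nonempty
  \<open>L\<close>.\<close>

locale cnf_layout =
  fixes \<phi> :: "nat cnf" and L :: "nat list" and \<H> :: "nat set set" and b :: nat
  assumes layout: "layout b \<H> L"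
    and clauses: "\<And>C. C \<in> \<phi> \<Longrightarrow> clause_vars C \<in> \<H>"
    and satisfiable: "\<exists>a. \<forall>C\<in>\<phi>. satisfies a C"
    and falsified: "\<exists>a. \<exists>C\<in>\<phi>. \<not> satisfies a C"
begin

abbreviation "pre i \<equiv> set (take i L)"
abbreviation "suf i \<equiv> set (drop i L)"

definition bd :: "nat \<Rightarrow> nat set" where
  "bd i = boundary \<H> (pre i) (suf i)"

definition ok :: "nat \<Rightarrow> nat set \<Rightarrow> bool" where
  "ok i a \<longleftrightarrow> (\<forall>C\<in>\<phi>. clause_vars C \<subseteq> pre i \<longrightarrow> satisfies a C)"

text \<open>
  The node \<open>node i c\<close> is reached after the first \<open>i\<close> variables if all clauses within them are
  satisfied and \<open>c\<close> is the set of true variables among those that still matter; only nodes that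
  are actually reached are kept, since an OBDD has a single source. The offset 2 leaves room for the
  sinks 1 (true) and 0 (false).
\<close>

definition node :: "nat \<Rightarrow> nat set \<Rightarrow> nat" where
  "node i c = prod_encode (i, set_encode c) + 2"

definition lev :: "nat \<Rightarrow> nat" where
  "lev u = fst (prod_decode (u - 2))"

definition state :: "nat \<Rightarrow> nat set" where
  "state u = set_decode (snd (prod_decode (u - 2)))"

text \<open>A nonempty clause is tested only at the step that reads its last variable, when the
  values of its other variables are still remembered.\<close>

definition next_node :: "nat \<Rightarrow> bool \<Rightarrow> nat" where
  "next_node u c = (let i = lev u; s = (if c then insert (L ! i) (state u) else state u) in
     if \<forall>C\<in>\<phi>. clause_vars C \<subseteq> pre (Suc i) \<and> L ! i \<in> clause_vars C \<longrightarrow> satisfies s C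
     then if Suc i = length L then 1 else node (Suc i) (s \<inter> bd (Suc i))
     else 0)"

definition nodes :: "nat set" where
  "nodes = {node i (a \<inter> bd i) | i a. i < length L \<and> ok i a}"

lemma node_in_nodes: "i < length L \<Longrightarrow> ok i a \<Longrightarrow> node i (a \<inter> bd i) \<in> nodes"
  unfolding nodes_def by blast

lemma distinct_L: "distinct L"
  using layout by (simp add: layout_def)

lemma clause_vars_L: "C \<in> \<phi> \<Longrightarrow> clause_vars C \<subseteq> set L"
  using layout clauses by (auto simp: layout_def)

lemma pre_Suc: "i < length L \<Longrightarrow> pre (Suc i) = insert (L ! i) (pre i)"
  by (simp add: take_Suc_conv_app_nth)

lemma suf_conv: "i < length L \<Longrightarrow> suf i = insert (L ! i) (suf (Suc i))"
  by (metis Cons_nth_drop_Suc list.simps(15))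

lemma pre_suf_disjoint: "pre i \<inter> suf i = {}"
  using distinct_L by (intro set_take_disj_set_drop_if_distinct) auto

lemma pre_Un_suf: "pre i \<union> suf i = set L"
  by (metis append_take_drop_id set_append)

lemma nth_notin: "i < length L \<Longrightarrow> L ! i \<notin> pre i"
  using pre_suf_disjoint[of i] suf_conv[of i] by blast

lemma bd_sub: "bd i \<subseteq> pre i"
  by (auto simp: bd_def boundary_def)

lemma finite_bd: "finite (bd i)"
  using bd_sub by (rule finite_subset) simp

lemma card_bd: "card (bd i) \<le> b"
  using layout unfolding layout_def bd_def by (metis append_take_drop_id)

lemma bd_Suc: "i < length L \<Longrightarrow> bd (Suc i) \<subseteq> insert (L ! i) (bd i)"
  unfolding bd_def boundary_def using pre_Suc[of i] suf_conv[of i] by auto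

text \<open>An unfinished clause touches the unread part, which puts its read variables on the
  boundary; this is why the boundary values suffice.\<close>

lemma clause_pre_bd:
  assumes "C \<in> \<phi>" "\<not> clause_vars C \<subseteq> pre i"
  shows "clause_vars C \<inter> pre i \<subseteq> bd i"
proof -
  have "clause_vars C \<inter> suf i \<noteq> {}" using clause_vars_L[OF assms(1)] assms(2) pre_Un_suf[of i] by blast
  then show ?thesis using clauses[OF assms(1)] by (auto simp: bd_def boundary_def)
qed

lemma node_sel [simp]: "lev (node i c) = i" "finite c \<Longrightarrow> state (node i c) = c"
  by (simp_all add: node_def lev_def state_def set_encode_inverse)

lemma node_gt: "node i c \<noteq> 0" "node i c \<noteq> 1"
  by (simp_all add: node_def)

lemma node_state [simp]: "state (node i (a \<inter> bd i)) = a \<inter> bd i"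
  by (simp add: finite_bd)

lemma ok_cong: "(\<And>x. x \<in> pre i \<Longrightarrow> x \<in> a \<longleftrightarrow> x \<in> a') \<Longrightarrow> ok i a \<longleftrightarrow> ok i a'"
  unfolding ok_def by (meson satisfies_cong subsetD)

lemma ok_Suc:
  assumes "i < length L"
  shows "ok (Suc i) a \<longleftrightarrow> ok i a \<and>
    (\<forall>C\<in>\<phi>. clause_vars C \<subseteq> pre (Suc i) \<and> L ! i \<in> clause_vars C \<longrightarrow> satisfies a C)"
  unfolding ok_def using pre_Suc[OF assms] by auto

text \<open>The state forgets \<open>a\<close> outside \<open>bd i\<close>, but a clause completed
  by \<open>L ! i\<close> has its other variables in \<open>bd i\<close>, and
  \<open>bd (Suc i)\<close> gains at most \<open>L ! i\<close>. The step is thus independent of the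
  \<open>a\<close> that represents the node.\<close>

lemma next_node:
  assumes "i < length L" "ok i a"
  shows "next_node (node i (a \<inter> bd i)) (L ! i \<in> a) =
    (if ok (Suc i) a then if Suc i = length L then 1 else node (Suc i) (a \<inter> bd (Suc i)) else 0)"
proof -
  define s where "s = (if L ! i \<in> a then insert (L ! i) (a \<inter> bd i) else a \<inter> bd i)"
  have s: "x \<in> s \<longleftrightarrow> x \<in> a" if "x \<in> insert (L ! i) (bd i)" for x
    using that bd_sub[of i] nth_notin[OF assms(1)] by (auto simp: s_def)
  have "satisfies s C \<longleftrightarrow> satisfies a C"
    if "C \<in> \<phi>" "clause_vars C \<subseteq> pre (Suc i)" "L ! i \<in> clause_vars C" for C
  proof (rule satisfies_cong)
    fix x assume x: "x \<in> clause_vars C"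
    have "\<not> clause_vars C \<subseteq> pre i" using that(3) nth_notin[OF assms(1)] by blast
    then have "x \<in> insert (L ! i) (bd i)"
      using clause_pre_bd[OF that(1)] that(2) x pre_Suc[OF assms(1)] by blast
    then show "x \<in> s \<longleftrightarrow> x \<in> a" by (rule s)
  qed
  then have ok: "(\<forall>C\<in>\<phi>. clause_vars C \<subseteq> pre (Suc i) \<and> L ! i \<in> clause_vars C \<longrightarrow> satisfies s C) \<longleftrightarrow> ok (Suc i) a"
    using ok_Suc[OF assms(1), of a] assms(2) by auto
  have bd: "s \<inter> bd (Suc i) = a \<inter> bd (Suc i)" using s bd_Suc[OF assms(1)] by blast
  show ?thesis
    unfolding next_node_def Let_def node_sel(1) node_state s_def[symmetric] ok bd ..
qed

text \<open>\<open>L ! i\<close> is still unread, so \<open>a\<close> can be changed there without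
  affecting \<open>ok i a\<close> or the state. Every arc is thereby the step of some
  \<open>a\<close>, to which the lemma \<open>next_node\<close> applies.\<close>

lemma node_with_bit:
  assumes "u \<in> nodes"
  obtains i a where "i < length L" "ok i a" "u = node i (a \<inter> bd i)" "c \<longleftrightarrow> L ! i \<in> a"
proof -
  obtain i a where ia: "i < length L" "ok i a" "u = node i (a \<inter> bd i)"
    using assms by (auto simp: nodes_def)
  define a' where "a' = (if c then insert (L ! i) a else a - {L ! i})"
  have "L ! i \<notin> pre i" by (rule nth_notin[OF ia(1)])
  then have eq: "x \<in> a \<longleftrightarrow> x \<in> a'" if "x \<in> pre i" for x using that by (auto simp: a'_def)
  then have "ok i a'" using ok_cong[of i a a'] ia(2) by blast
  moreover have "a \<inter> bd i = a' \<inter> bd i" using eq bd_sub[of i] by blast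
  moreover have "c \<longleftrightarrow> L ! i \<in> a'" by (simp add: a'_def)
  ultimately show ?thesis using that ia by metis
qed

lemma satisfiable_ok: "\<exists>a. \<forall>i. ok i a"
  using satisfiable unfolding ok_def by blast

lemma ok_0: "ok 0 a"
  unfolding ok_def
proof (intro ballI impI)
  fix C assume "C \<in> \<phi>" "clause_vars C \<subseteq> pre 0"
  \<comment> \<open>Only the empty clause lies within the empty prefix, and satisfiability excludes
    it.\<close>
  then have "C = {}" by (simp add: clause_vars_def)
  then show "satisfies a C" using satisfiable \<open>C \<in> \<phi>\<close> by (auto simp: satisfies_def)
qed

lemma ok_length: "ok (length L) a \<longleftrightarrow> (\<forall>C\<in>\<phi>. satisfies a C)"
  unfolding ok_def using clause_vars_L by auto

lemma length_pos: "0 < length L"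
proof (rule ccontr)
  assume "\<not> 0 < length L"
  then show False using ok_0 ok_length falsified by auto
qed

sublocale layered L nodes lev next_node "node 0 {}" 1 0
proof
  show "distinct L" by (rule distinct_L)
  have "nodes \<subseteq> (\<Union>i<length L. node i ` Pow (bd i))" by (auto simp: nodes_def)
  moreover have "finite (\<Union>i<length L. node i ` Pow (bd i))" using finite_bd by blast
  ultimately show "finite nodes" by (rule finite_subset)
  show "1 \<notin> nodes" "0 \<notin> nodes" by (auto simp: nodes_def node_def)
  show "(1 :: nat) \<noteq> 0" by simp
  show "lev u < length L" if "u \<in> nodes" for u using that by (auto simp: nodes_def)
  obtain a where a: "\<And>i. ok i a" using satisfiable_ok by blast
  show "\<exists>u\<in>nodes. lev u = i" if "i < length L" for i
    using that a by (intro bexI[of _ "node i (a \<inter> bd i)"]) (simp_all add: node_in_nodes)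
  show "next_node u c \<in> nodes \<union> {1, 0}" if u: "u \<in> nodes" for u c
  proof -
    obtain i a where ia: "i < length L" "ok i a" "u = node i (a \<inter> bd i)" "c \<longleftrightarrow> L ! i \<in> a"
      using node_with_bit[OF u] by metis
    have "node (Suc i) (a \<inter> bd (Suc i)) \<in> nodes" if "ok (Suc i) a" "Suc i \<noteq> length L"
      using that ia(1) by (intro node_in_nodes) simp_all
    then show ?thesis using next_node[OF ia(1,2)] ia(3,4) by simp
  qed
  show "lev (next_node u c) = Suc (lev u)" if u: "u \<in> nodes" "next_node u c \<in> nodes" for u c
  proof -
    obtain i a where ia: "i < length L" "ok i a" "u = node i (a \<inter> bd i)" "c \<longleftrightarrow> L ! i \<in> a"
      using node_with_bit[OF u(1)] by metis
    show ?thesis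
      using next_node[OF ia(1,2)] ia(3,4) u(2) \<open>1 \<notin> nodes\<close> \<open>0 \<notin> nodes\<close> by (auto split: if_splits)
  qed
  show "node 0 {} \<in> nodes" using node_in_nodes[OF length_pos ok_0[of "{}"]] by simp
  show "lev (node 0 {}) = 0" by simp
  show "\<exists>u\<in>nodes. \<exists>c. next_node u c = v" if v: "v \<in> nodes \<union> {1, 0}" "v \<noteq> node 0 {}" for v
  proof -
    have pred: "\<exists>u\<in>nodes. \<exists>c. next_node u c = v"
      if "i < length L" "ok i a" "v = (if ok (Suc i) a then if Suc i = length L then 1
        else node (Suc i) (a \<inter> bd (Suc i)) else 0)" for i a
      using next_node[OF that(1,2)] that
      by (intro bexI[of _ "node i (a \<inter> bd i)"] exI[of _ "L ! i \<in> a"]) (simp_all add: node_in_nodes)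
    consider "v \<in> nodes" | "v = 1" | "v = 0" using v(1) by blast
    then show ?thesis
    proof cases
      case 1
      then obtain i a where ia: "i < length L" "ok i a" "v = node i (a \<inter> bd i)"
        by (auto simp: nodes_def)
      have "bd 0 = {}" using bd_sub[of 0] by simp
      then obtain j where j: "i = Suc j" using ia(3) v(2) by (cases i) auto
      then have "ok j a" using ok_Suc[of j a] ia by simp
      then show ?thesis using pred[of j a] ia j by simp
    next
      case 2
      obtain j where "length L = Suc j" using length_pos by (cases "length L") auto
      then show ?thesis using pred[of j a] a 2 by simp
    next
      case 3
      obtain e where e: "\<not> ok (length L) e" using falsified ok_length by blast
      \<comment> \<open>The first prefix in which the falsifying \<open>e\<close> violates a clause;
        the step completing it leads to the false sink.\<close>
      define i where "i = (LEAST i. \<not> ok i e)"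
      have i: "\<not> ok i e" "i \<le> length L" unfolding i_def by (rule LeastI[of "\<lambda>i. \<not> ok i e", OF e], rule Least_le[of "\<lambda>i. \<not> ok i e", OF e])
      obtain j where j: "i = Suc j" using i(1) ok_0 by (cases i) auto
      have "ok j e" using not_less_Least[of j "\<lambda>i. \<not> ok i e"] j unfolding i_def by simp
      then show ?thesis using pred[of j e] i j 3 by simp
    qed
  qed
qed

text \<open>The residual function at \<open>u\<close>. Clauses within the read prefix are left out
  because they hold at every node; the sinks are listed separately because \<open>lev\<close> and
  \<open>state\<close> are meaningless there.\<close>

definition sem :: "nat literal set \<Rightarrow> nat \<Rightarrow> bool" where
  "sem S u \<longleftrightarrow> u = 1 \<or> (u \<noteq> 0 \<and> (\<forall>C\<in>\<phi>. \<not> clause_vars C \<subseteq> pre (lev u) \<longrightarrow>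
     satisfies (state u \<union> ({x. Pos x \<in> S} \<inter> suf (lev u))) C))"

text \<open>The state may be replaced by all of \<open>e\<close> on the prefix: completed clauses
  hold by \<open>ok\<close>, and the others see the prefix only through \<open>bd i\<close>.\<close>

lemma sem_node:
  assumes "ok i e" "i < length L"
  shows "sem S (node i (e \<inter> bd i)) \<longleftrightarrow> (\<forall>C\<in>\<phi>. satisfies ((e \<inter> pre i) \<union> ({x. Pos x \<in> S} \<inter> suf i)) C)"
    (is "_ \<longleftrightarrow> (\<forall>C\<in>\<phi>. satisfies ?g C)")
proof -
  let ?h = "(e \<inter> bd i) \<union> ({x. Pos x \<in> S} \<inter> suf i)"
  have inside: "satisfies ?g C" if "C \<in> \<phi>" "clause_vars C \<subseteq> pre i" for C
  proof -
    have "satisfies ?g C \<longleftrightarrow> satisfies e C"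
      by (rule satisfies_cong) (use that(2) pre_suf_disjoint[of i] in auto)
    then show ?thesis using assms(1) that by (simp add: ok_def)
  qed
  have outside: "satisfies ?h C \<longleftrightarrow> satisfies ?g C" if "C \<in> \<phi>" "\<not> clause_vars C \<subseteq> pre i" for C
    by (rule satisfies_cong) (use clause_pre_bd[OF that] bd_sub[of i] in auto)
  have "sem S (node i (e \<inter> bd i)) \<longleftrightarrow> (\<forall>C\<in>\<phi>. \<not> clause_vars C \<subseteq> pre i \<longrightarrow> satisfies ?h C)"
    using node_gt by (simp add: sem_def)
  then show ?thesis using inside outside by blast
qed

text \<open>If \<open>e\<close> agrees with \<open>S\<close> at \<open>L ! i\<close>, the hybrid of
  \<open>e\<close> on the prefix and \<open>S\<close> on the rest is the same for \<open>i\<close>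
  and \<open>Suc i\<close>. Only the steps into the sinks remain to be compared with it.\<close>

lemma sem_step:
  assumes "u \<in> nodes"
  shows "sem S (next_node u (Pos (L ! lev u) \<in> S)) \<longleftrightarrow> sem S u"
proof -
  obtain i e where ie: "i < length L" "ok i e" "u = node i (e \<inter> bd i)" "Pos (L ! lev u) \<in> S \<longleftrightarrow> L ! i \<in> e"
    using node_with_bit[OF assms] by metis
  let ?g = "\<lambda>i. (e \<inter> pre i) \<union> ({x. Pos x \<in> S} \<inter> suf i)"
  have bit: "Pos (L ! i) \<in> S \<longleftrightarrow> L ! i \<in> e" using ie(3,4) by simp
  have g: "?g (Suc i) = ?g i"
    using bit unfolding pre_Suc[OF ie(1)] suf_conv[OF ie(1)] by auto
  have next_u: "next_node u (Pos (L ! lev u) \<in> S) =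
    (if ok (Suc i) e then if Suc i = length L then 1 else node (Suc i) (e \<inter> bd (Suc i)) else 0)"
    using next_node[OF ie(1,2)] ie(3) bit by simp
  have semu: "sem S u \<longleftrightarrow> (\<forall>C\<in>\<phi>. satisfies (?g (Suc i)) C)"
    unfolding ie(3) g by (rule sem_node[OF ie(2,1)])
  have ge: "satisfies (?g (Suc i)) C \<longleftrightarrow> satisfies e C" if "clause_vars C \<subseteq> pre (Suc i)" for C
    by (rule satisfies_cong) (use that pre_suf_disjoint[of "Suc i"] in auto)
  consider "\<not> ok (Suc i) e" | "ok (Suc i) e" "Suc i = length L" | "ok (Suc i) e" "Suc i < length L"
    using ie(1) by linarith
  then show ?thesis
  proof cases
    case 1
    then have "\<not> sem S u" unfolding semu using ge by (auto simp: ok_def)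
    then show ?thesis unfolding next_u using 1 by (simp add: sem_def)
  next
    case 2
    then have "\<forall>C\<in>\<phi>. satisfies e C" using ok_length by metis
    then have "sem S u" unfolding semu using ge clause_vars_L 2(2) by simp
    then show ?thesis unfolding next_u using 2 by (simp add: sem_def)
  next
    case 3
    then show ?thesis unfolding next_u semu using sem_node[OF 3] by simp
  qed
qed

lemma models_Z: "obdd_models Z = {S \<in> assignments (set L). \<forall>C\<in>\<phi>. C \<inter> S \<noteq> {}}"
proof -
  have "obdd_models Z = {S \<in> assignments (set L). sem S (node 0 {})}"
    by (rule obdd_models_Z) (simp_all add: sem_step, simp add: sem_def)
  moreover have "sem S (node 0 {}) \<longleftrightarrow> (\<forall>C\<in>\<phi>. C \<inter> S \<noteq> {})" if "S \<in> assignments (set L)" for S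
  proof -
    have "sem S (node 0 {}) \<longleftrightarrow> (\<forall>C\<in>\<phi>. satisfies ({x. Pos x \<in> S} \<inter> set L) C)"
      using sem_node[of 0 "{}" S] ok_0 length_pos by simp
    moreover have "satisfies ({x. Pos x \<in> S} \<inter> set L) C \<longleftrightarrow> satisfies {x. Pos x \<in> S} C" if "C \<in> \<phi>" for C
      by (rule satisfies_cong) (use clause_vars_L[OF that] in auto)
    ultimately show ?thesis using satisfies_assignment[OF that] clause_vars_L by simp
  qed
  ultimately show ?thesis by auto
qed

lemma size_Z: "obdd_size Z \<le> length L * 2 ^ b + 2"
proof -
  have "nodes \<subseteq> (\<Union>i<length L. node i ` Pow (bd i))" by (auto simp: nodes_def)
  moreover have "finite (\<Union>i<length L. node i ` Pow (bd i))" using finite_bd by blast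
  ultimately have "card nodes \<le> card (\<Union>i<length L. node i ` Pow (bd i))" by (intro card_mono)
  also have "\<dots> \<le> (\<Sum>i<length L. card (node i ` Pow (bd i)))" by (rule card_UN_le) simp
  also have "\<dots> \<le> (\<Sum>i<length L. 2 ^ b)"
  proof (rule sum_mono)
    fix i
    have "card (node i ` Pow (bd i)) \<le> card (Pow (bd i))" using finite_bd by (intro card_image_le) simp
    also have "\<dots> \<le> 2 ^ b" using card_bd finite_bd by (simp add: card_Pow)
    finally show "card (node i ` Pow (bd i)) \<le> 2 ^ b" .
  qed
  finally have "card nodes \<le> length L * 2 ^ b" by simp
  then show ?thesis unfolding obdd_size_Z by simp
qed

end

lemma layout_obdd:
  assumes "layout b \<H> L" "\<And>C. C \<in> \<phi> \<Longrightarrow> clause_vars C \<in> \<H>"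
    "\<exists>a. \<forall>C\<in>\<phi>. satisfies a C" "\<exists>a. \<exists>C\<in>\<phi>. \<not> satisfies a C"
  shows "\<exists>Z :: (nat, nat, nat) obdd. is_obdd Z \<and> obdd_vars Z = set L \<and> obdd_size Z \<le> length L * 2 ^ b + 2 \<and>
    obdd_models Z = {S \<in> assignments (set L). \<forall>C\<in>\<phi>. C \<inter> S \<noteq> {}}"
proof -
  interpret cnf_layout \<phi> L \<H> b using assms by unfold_locales
  show ?thesis using is_obdd_Z obdd_vars_Z size_Z models_Z by blast
qed

section \<open>Representing a CNF by two OBDDs\<close>

definition two_obdd_representable :: "nat cnf \<Rightarrow> nat \<Rightarrow> bool" where
  "two_obdd_representable \<phi> m \<longleftrightarrow> (\<exists>Z1 Z2 :: (nat, nat, nat) obdd. is_obdd Z1 \<and> is_obdd Z2 \<and>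
     conjunction_represents Z1 Z2 \<phi> \<and> (\<forall>Z\<in>{Z1, Z2}. obdd_size Z \<le> m))"

lemma two_obdd_representableI:
  fixes Z1 Z2 :: "(nat, nat, nat) obdd"
  assumes "is_obdd Z1" "is_obdd Z2" "conjunction_models Z1 Z2 = cnf_models \<phi>" "obdd_size Z1 \<le> m" "obdd_size Z2 \<le> m"
  shows "two_obdd_representable \<phi> m"
  unfolding two_obdd_representable_def conjunction_represents_def
  using assms by (intro exI[of _ Z1] exI[of _ Z2]) simp

lemma two_obdd_representable_mono:
  assumes "two_obdd_representable \<phi> m" "m \<le> n"
  shows "two_obdd_representable \<phi> n"
proof -
  obtain Z1 Z2 :: "(nat, nat, nat) obdd" where Z: "is_obdd Z1" "is_obdd Z2" "conjunction_represents Z1 Z2 \<phi>"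
    "\<forall>Z\<in>{Z1, Z2}. obdd_size Z \<le> m"
    using assms(1) unfolding two_obdd_representable_def by (elim exE conjE) (rule that)
  then have "obdd_size Z1 \<le> n" "obdd_size Z2 \<le> n" using assms(2) by simp_all
  then show ?thesis
    by (rule two_obdd_representableI[OF Z(1,2) Z(3)[unfolded conjunction_represents_def]])
qed

lemma restrict_assignment_assignments:
  assumes "S \<in> assignments X" "V \<subseteq> X"
  shows "restrict_assignment S V \<in> assignments V"
  using assms by (auto simp: assignments_def restrict_assignment_def)

lemma Int_restrict_assignment:
  assumes "clause_vars C \<subseteq> V"
  shows "C \<inter> restrict_assignment S V = C \<inter> S"
  using assms by (auto simp: restrict_assignment_def clause_vars_def)

lemma conjunction_models_conv:
  assumes "obdd_vars Z1 = V1" "obdd_models Z1 = {S \<in> assignments V1. \<forall>C\<in>\<phi>1. C \<inter> S \<noteq> {}}"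
    and "obdd_vars Z2 = V2" "obdd_models Z2 = {S \<in> assignments V2. \<forall>C\<in>\<phi>2. C \<inter> S \<noteq> {}}"
    and "\<And>C. C \<in> \<phi>1 \<Longrightarrow> clause_vars C \<subseteq> V1" "\<And>C. C \<in> \<phi>2 \<Longrightarrow> clause_vars C \<subseteq> V2"
  shows "conjunction_models Z1 Z2 = {S \<in> assignments (V1 \<union> V2). \<forall>C\<in>\<phi>1 \<union> \<phi>2. C \<inter> S \<noteq> {}}"
proof -
  have 1: "restrict_assignment S V1 \<in> obdd_models Z1 \<longleftrightarrow> (\<forall>C\<in>\<phi>1. C \<inter> S \<noteq> {})"
    if "S \<in> assignments (V1 \<union> V2)" for S
    using restrict_assignment_assignments[OF that, of V1] Int_restrict_assignment[OF assms(5)]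
    unfolding assms(2) by simp
  have 2: "restrict_assignment S V2 \<in> obdd_models Z2 \<longleftrightarrow> (\<forall>C\<in>\<phi>2. C \<inter> S \<noteq> {})"
    if "S \<in> assignments (V1 \<union> V2)" for S
    using restrict_assignment_assignments[OF that, of V2] Int_restrict_assignment[OF assms(6)]
    unfolding assms(4) by simp
  show ?thesis unfolding conjunction_models_def assms(1,3) using 1 2 by blast
qed

lemma clause_vars_subset: "C \<in> \<phi> \<Longrightarrow> clause_vars C \<subseteq> cnf_vars \<phi>"
  by (auto simp: cnf_vars_def)

lemma finite_cnf_vars: "is_cnf \<phi> \<Longrightarrow> finite (cnf_vars \<phi>)"
  by (auto simp: is_cnf_def cnf_vars_def clause_vars_def)

lemma satisfies_if_model:
  assumes "cnf_models \<phi> \<noteq> {}"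
  shows "\<exists>a. \<forall>C\<in>\<phi>. satisfies a C"
proof -
  obtain S where S: "S \<in> assignments (cnf_vars \<phi>)" "\<forall>C\<in>\<phi>. C \<inter> S \<noteq> {}"
    using assms by (auto simp: cnf_models_def)
  then have "\<forall>C\<in>\<phi>. satisfies {x. Pos x \<in> S} C"
    using satisfies_assignment[OF S(1) clause_vars_subset] by blast
  then show ?thesis by blast
qed

lemma falsifies_if_falsifiable:
  assumes "falsifiable \<phi>"
  shows "\<exists>a. \<exists>C\<in>\<phi>. \<not> satisfies a C"
proof -
  obtain S C where S: "S \<in> assignments (cnf_vars \<phi>)" "C \<in> \<phi>" "C \<inter> S = {}"
    using assms by (auto simp: falsifiable_def cnf_models_def)
  then have "\<not> satisfies {x. Pos x \<in> S} C"
    using satisfies_assignment[OF S(1) clause_vars_subset] by blast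
  then show ?thesis using S(2) by blast
qed

text \<open>Without models the variables of \<phi> do not matter: OBDDs for the variable
  \<open>0\<close> and for its negation have no common model. Each has at most
  \<open>1 * 2 ^ 1 + 2\<close> nodes.\<close>

lemma represents_contradiction:
  assumes "cnf_models \<phi> = {}"
  shows "two_obdd_representable \<phi> 4"
proof -
  have lay: "layout 1 {{0}} [0 :: nat]" by (intro layout_small) auto
  have pos: "satisfies a {Pos 0} \<longleftrightarrow> 0 \<in> a" and neg: "satisfies a {Neg 0} \<longleftrightarrow> 0 \<notin> a" for a :: "nat set"
    by (auto simp: satisfies_def)
  obtain Z1 :: "(nat, nat, nat) obdd" where Z1: "is_obdd Z1" "obdd_vars Z1 = {0}" "obdd_size Z1 \<le> 4"
    "obdd_models Z1 = {S \<in> assignments {0}. \<forall>C\<in>{{Pos 0}}. C \<inter> S \<noteq> {}}"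
    using layout_obdd[OF lay, of "{{Pos 0}}"] pos by (auto simp: clause_vars_def)
  obtain Z2 :: "(nat, nat, nat) obdd" where Z2: "is_obdd Z2" "obdd_vars Z2 = {0}" "obdd_size Z2 \<le> 4"
    "obdd_models Z2 = {S \<in> assignments {0}. \<forall>C\<in>{{Neg 0}}. C \<inter> S \<noteq> {}}"
    using layout_obdd[OF lay, of "{{Neg 0}}"] neg by (auto simp: clause_vars_def)
  have "conjunction_models Z1 Z2 = {S \<in> assignments ({0} \<union> {0}). \<forall>C\<in>{{Pos 0}} \<union> {{Neg 0}}. C \<inter> S \<noteq> {}}"
    by (rule conjunction_models_conv[OF Z1(2,4) Z2(2,4)]) (auto simp: clause_vars_def)
  also have "\<dots> = {}" by (auto simp: assignments_def)
  finally have "conjunction_models Z1 Z2 = cnf_models \<phi>" using assms by simp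
  then show ?thesis by (rule two_obdd_representableI[OF Z1(1) Z2(1) _ Z1(3) Z2(3)])
qed

lemma represents_two_layouts:
  assumes "layout b \<H>1 L1" "layout b \<H>2 L2" "set L1 = cnf_vars \<phi>" "set L2 = cnf_vars \<phi>"
    and cover: "\<And>C. C \<in> \<phi> \<Longrightarrow> clause_vars C \<in> \<H>1 \<or> clause_vars C \<in> \<H>2"
    and sat: "cnf_models \<phi> \<noteq> {}" and fal: "falsifiable \<phi>"
  shows "two_obdd_representable \<phi> (card (cnf_vars \<phi>) * 2 ^ b + 2)"
proof -
  define \<phi>1 where "\<phi>1 = {C \<in> \<phi>. clause_vars C \<in> \<H>1}"
  define \<phi>2 where "\<phi>2 = {C \<in> \<phi>. clause_vars C \<in> \<H>2}"
  have \<phi>: "\<phi> = \<phi>1 \<union> \<phi>2" using cover by (auto simp: \<phi>1_def \<phi>2_def)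
  have obdd: "\<exists>Z :: (nat, nat, nat) obdd. is_obdd Z \<and> obdd_vars Z = cnf_vars \<phi> \<and>
      obdd_size Z \<le> card (cnf_vars \<phi>) * 2 ^ b + 2 \<and>
      obdd_models Z = {S \<in> assignments (cnf_vars \<phi>). \<forall>C\<in>\<psi>. C \<inter> S \<noteq> {}}"
    if "layout b \<H> L" "set L = cnf_vars \<phi>" "\<psi> \<subseteq> \<phi>" "\<And>C. C \<in> \<psi> \<Longrightarrow> clause_vars C \<in> \<H>"
      "\<exists>a. \<exists>C\<in>\<psi>. \<not> satisfies a C" for \<psi> \<H> L
  proof -
    have "length L = card (cnf_vars \<phi>)"
      using that(1,2) distinct_card[of L] by (simp add: layout_def)
    moreover have "\<exists>a. \<forall>C\<in>\<psi>. satisfies a C" using satisfies_if_model[OF sat] that(3) by blast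
    ultimately show ?thesis using layout_obdd[OF that(1,4) _ that(5)] that(2) by simp
  qed
  \<comment> \<open>Stated for arbitrary parts, which may coincide and may omit valid clauses; this
    serves the cases below in which one part is valid.\<close>
  have conj: ?thesis
    if h: "\<psi>1 \<subseteq> \<phi>" "\<psi>2 \<subseteq> \<phi>" "\<And>C. C \<in> \<psi>1 \<Longrightarrow> clause_vars C \<in> \<G>1" "\<And>C. C \<in> \<psi>2 \<Longrightarrow> clause_vars C \<in> \<G>2"
      "layout b \<G>1 K1" "layout b \<G>2 K2" "set K1 = cnf_vars \<phi>" "set K2 = cnf_vars \<phi>"
      "\<exists>a. \<exists>C\<in>\<psi>1. \<not> satisfies a C" "\<exists>a. \<exists>C\<in>\<psi>2. \<not> satisfies a C"
      "\<And>C a. C \<in> \<phi> \<Longrightarrow> C \<notin> \<psi>1 \<union> \<psi>2 \<Longrightarrow> satisfies a C" for \<psi>1 \<psi>2 \<G>1 \<G>2 K1 K2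
  proof -
    obtain Z1 :: "(nat, nat, nat) obdd" where Z1: "is_obdd Z1" "obdd_vars Z1 = cnf_vars \<phi>"
      "obdd_size Z1 \<le> card (cnf_vars \<phi>) * 2 ^ b + 2"
      "obdd_models Z1 = {S \<in> assignments (cnf_vars \<phi>). \<forall>C\<in>\<psi>1. C \<inter> S \<noteq> {}}"
      using obdd[OF h(5,7,1,3,9)] by blast
    obtain Z2 :: "(nat, nat, nat) obdd" where Z2: "is_obdd Z2" "obdd_vars Z2 = cnf_vars \<phi>"
      "obdd_size Z2 \<le> card (cnf_vars \<phi>) * 2 ^ b + 2"
      "obdd_models Z2 = {S \<in> assignments (cnf_vars \<phi>). \<forall>C\<in>\<psi>2. C \<inter> S \<noteq> {}}"
      using obdd[OF h(6,8,2,4,10)] by blast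
    have "conjunction_models Z1 Z2 =
        {S \<in> assignments (cnf_vars \<phi> \<union> cnf_vars \<phi>). \<forall>C\<in>\<psi>1 \<union> \<psi>2. C \<inter> S \<noteq> {}}"
      by (rule conjunction_models_conv[OF Z1(2,4) Z2(2,4)])
        (use clause_vars_subset h(1,2) in blast)+
    also have "\<dots> = cnf_models \<phi>"
    proof -
      have valid: "C \<inter> S \<noteq> {}" if "C \<in> \<phi>" "C \<notin> \<psi>1 \<union> \<psi>2" "S \<in> assignments (cnf_vars \<phi>)" for C S
        using satisfies_assignment[OF that(3) clause_vars_subset[OF that(1)]]
          h(11)[OF that(1,2)] by blast
      have "(\<forall>C\<in>\<psi>1 \<union> \<psi>2. C \<inter> S \<noteq> {}) \<longleftrightarrow> (\<forall>C\<in>\<phi>. C \<inter> S \<noteq> {})"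
        if "S \<in> assignments (cnf_vars \<phi>)" for S
        using valid[OF _ _ that] h(1,2) by blast
      then show ?thesis unfolding cnf_models_def Un_absorb by blast
    qed
    finally show ?thesis by (rule two_obdd_representableI[OF Z1(1) Z2(1) _ Z1(3) Z2(3)])
  qed
  have sub: "\<phi>1 \<subseteq> \<phi>" "\<phi>2 \<subseteq> \<phi>" "\<And>C. C \<in> \<phi>1 \<Longrightarrow> clause_vars C \<in> \<H>1" "\<And>C. C \<in> \<phi>2 \<Longrightarrow> clause_vars C \<in> \<H>2"
    by (auto simp: \<phi>1_def \<phi>2_def)
  have fals: "\<exists>a. \<exists>C\<in>\<phi>1 \<union> \<phi>2. \<not> satisfies a C" using falsifies_if_falsifiable[OF fal] \<phi> by simp
  \<comment> \<open>An OBDD never computes a constant function, so a valid part is replaced by the other one.\<close>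
  consider "\<exists>a. \<exists>C\<in>\<phi>1. \<not> satisfies a C" "\<exists>a. \<exists>C\<in>\<phi>2. \<not> satisfies a C"
    | "\<exists>a. \<exists>C\<in>\<phi>1. \<not> satisfies a C" "\<forall>a. \<forall>C\<in>\<phi>2. satisfies a C"
    | "\<forall>a. \<forall>C\<in>\<phi>1. satisfies a C" "\<exists>a. \<exists>C\<in>\<phi>2. \<not> satisfies a C"
    using fals by blast
  then show ?thesis
  proof cases
    case 1
    show ?thesis by (rule conj[OF sub assms(1-4) 1]) (use \<phi> in auto)
  next
    case 2
    show ?thesis by (rule conj[OF sub(1,1,3,3) assms(1,1,3,3) 2(1,1)]) (use \<phi> 2(2) in auto)
  next
    case 3
    show ?thesis by (rule conj[OF sub(2,2,4,4) assms(2,2,4,4) 3(2,2)]) (use \<phi> 3(1) in auto)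
  qed
qed

text \<open>A hyperedge with at most one vertex cannot meet both sides of a cut. Nothing is
  remembered, so the OBDD has at most one node per variable besides the sinks.\<close>

lemma layout_singletons:
  assumes "distinct L"
  shows "layout 0 {H. H \<subseteq> set L \<and> card H \<le> 1} L"
  unfolding layout_def
proof (intro conjI allI impI)
  fix P T assume L: "L = P @ T"
  have "boundary {H. H \<subseteq> set L \<and> card H \<le> 1} (set P) (set T) = {}"
  proof (rule ccontr)
    assume "\<not> ?thesis"
    then obtain v u H where H: "H \<subseteq> set L" "card H \<le> 1" "v \<in> H" "v \<in> set P" "u \<in> H" "u \<in> set T"
      by (auto simp: boundary_def)
    moreover have "finite H" using H(1) finite_subset by blast
    ultimately have "u = v" using card_le_Suc0_iff_eq[of H] by simp
    then show False using assms L H by auto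
  qed
  then show "card (boundary {H. H \<subseteq> set L \<and> card H \<le> 1} (set P) (set T)) \<le> 0" by simp
qed (use assms in auto)

text \<open>
  Neither OBDD may be constant, so both of them read the variable \<open>x\<close> of a falsifiable clause. The
  remaining variables are divided so that neither OBDD reads more than \<open>n - 2\<close> variables; this
  is where \<open>n \<ge> 5\<close> is needed.
\<close>

lemma represents_unit_clauses:
  assumes "is_cnf \<phi>" "\<And>C. C \<in> \<phi> \<Longrightarrow> card (clause_vars C) \<le> 1" "5 \<le> card (cnf_vars \<phi>)"
    and sat: "cnf_models \<phi> \<noteq> {}" and fal: "falsifiable \<phi>"
  shows "two_obdd_representable \<phi> (card (cnf_vars \<phi>))"
proof -
  let ?V = "cnf_vars \<phi>"
  have fin: "finite ?V" using finite_cnf_vars[OF assms(1)] .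
  obtain a0 C0 where C0: "C0 \<in> \<phi>" "\<not> satisfies a0 C0" using falsifies_if_falsifiable[OF fal] by blast
  have "C0 \<noteq> {}" using satisfies_if_model[OF sat] C0(1) by (auto simp: satisfies_def)
  then obtain x where x: "x \<in> clause_vars C0" by (auto simp: clause_vars_def)
  have finC: "finite (clause_vars C)" if "C \<in> \<phi>" for C
    using clause_vars_subset[OF that] fin by (rule finite_subset)
  have one: "u = v" if "C \<in> \<phi>" "u \<in> clause_vars C" "v \<in> clause_vars C" for C u v
    using assms(2)[OF that(1)] card_le_Suc0_iff_eq[OF finC[OF that(1)]] that by simp
  have xV: "x \<in> ?V" using x C0(1) clause_vars_subset by blast
  have cx: "card (?V - {x}) = card ?V - 1" using xV fin by simp
  then have "2 \<le> card (?V - {x})" using assms(3) by linarith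
  \<comment> \<open>Two variables besides \<open>x\<close> give \<open>V1\<close> three variables
    and \<open>V2\<close> all but two, hence sizes of at most \<open>3 + 2\<close> and
    \<open>(n - 2) + 2\<close>.\<close>
  then obtain A where A: "A \<subseteq> ?V - {x}" "card A = 2" by (metis obtain_subset_with_card_n)
  define V1 where "V1 = insert x A"
  define V2 where "V2 = ?V - A"
  have finA: "finite A" using A(1) fin by (meson finite_Diff finite_subset)
  have c1: "card V1 = 3" using A finA by (auto simp: V1_def card_insert_if)
  have c2: "card V2 = card ?V - 2" unfolding V2_def using A finA by (subst card_Diff_subset) auto
  have V: "V1 \<union> V2 = ?V" "x \<in> V1" "x \<in> V2" using A(1) xV by (auto simp: V1_def V2_def)
  have obdd: "\<exists>Z :: (nat, nat, nat) obdd. is_obdd Z \<and> obdd_vars Z = W \<and> obdd_size Z \<le> card W + 2 \<and>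
      obdd_models Z = {S \<in> assignments W. \<forall>C\<in>{C \<in> \<phi>. clause_vars C \<subseteq> W}. C \<inter> S \<noteq> {}}"
    if W: "W \<subseteq> ?V" "x \<in> W" for W
  proof -
    obtain L where L: "set L = W" "distinct L"
      using finite_distinct_list finite_subset[OF W(1) fin] by blast
    have "clause_vars C0 \<subseteq> W" using one[OF C0(1)] x W(2) by blast
    then have "\<exists>a. \<exists>C\<in>{C \<in> \<phi>. clause_vars C \<subseteq> W}. \<not> satisfies a C" using C0 by blast
    moreover have "\<exists>a. \<forall>C\<in>{C \<in> \<phi>. clause_vars C \<subseteq> W}. satisfies a C"
      using satisfies_if_model[OF sat] by blast
    moreover have "clause_vars C \<in> {H. H \<subseteq> set L \<and> card H \<le> 1}" if "C \<in> {C \<in> \<phi>. clause_vars C \<subseteq> W}" for C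
      using that assms(2) L by auto
    ultimately show ?thesis
      using layout_obdd[OF layout_singletons[OF L(2)], of "{C \<in> \<phi>. clause_vars C \<subseteq> W}"] L distinct_card[OF L(2)]
      by simp
  qed
  obtain Z1 :: "(nat, nat, nat) obdd" where Z1: "is_obdd Z1" "obdd_vars Z1 = V1" "obdd_size Z1 \<le> card V1 + 2"
    "obdd_models Z1 = {S \<in> assignments V1. \<forall>C\<in>{C \<in> \<phi>. clause_vars C \<subseteq> V1}. C \<inter> S \<noteq> {}}"
    using obdd[of V1] V by blast
  obtain Z2 :: "(nat, nat, nat) obdd" where Z2: "is_obdd Z2" "obdd_vars Z2 = V2" "obdd_size Z2 \<le> card V2 + 2"
    "obdd_models Z2 = {S \<in> assignments V2. \<forall>C\<in>{C \<in> \<phi>. clause_vars C \<subseteq> V2}. C \<inter> S \<noteq> {}}"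
    using obdd[of V2] V by blast
  have "clause_vars C \<subseteq> V1 \<or> clause_vars C \<subseteq> V2" if "C \<in> \<phi>" for C
    using one[OF that] clause_vars_subset[OF that] V(1) by blast
  then have "{C \<in> \<phi>. clause_vars C \<subseteq> V1} \<union> {C \<in> \<phi>. clause_vars C \<subseteq> V2} = \<phi>" by blast
  then have "conjunction_models Z1 Z2 = cnf_models \<phi>"
    using conjunction_models_conv[OF Z1(2,4) Z2(2,4)] V(1) by (simp add: cnf_models_def)
  moreover have "obdd_size Z1 \<le> card ?V" "obdd_size Z2 \<le> card ?V" using Z1(3) Z2(3) c1 c2 assms(3) by auto
  ultimately show ?thesis by (rule two_obdd_representableI[OF Z1(1) Z2(1)])
qed

text \<open>Serves in contrapositive form: positive treewidth forces a variable to exist, so the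
  \<open>Max\<close> in \<open>cnf_Delta\<close> is over a nonempty set.\<close>

lemma treewidth_no_verts:
  assumes "pverts G = {}" "parcs G = {}"
  shows "treewidth G = 0"
proof -
  have 1: "decomposition_width \<lparr> pverts = {0 :: nat}, parcs = {} \<rparr> (\<lambda>_. pverts G) = 0"
    using assms by (simp add: decomposition_width_def)
  have 2: "tree_decomposition G \<lparr> pverts = {0 :: nat}, parcs = {} \<rparr> (\<lambda>_. pverts G)"
    using assms by (intro tree_decomposition_single) simp
  have "\<exists>(T :: nat pair_pre_digraph) B. tree_decomposition G T B \<and> decomposition_width T B = 0"
    by (rule exI, rule exI, rule conjI[OF 2 1])
  then show ?thesis unfolding treewidth_def by (rule Least_eq_0)
qed

section \<open>Clause sizes and degrees in the primal graph\<close>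

lemma primal_graph_facts:
  "pverts (primal_graph \<phi>) = cnf_vars \<phi>" "sym (parcs (primal_graph \<phi>))"
  "parcs (primal_graph \<phi>) \<subseteq> cnf_vars \<phi> \<times> cnf_vars \<phi>"
  unfolding primal_graph_def sym_def cnf_vars_def by auto

context
  fixes \<phi> :: "'v cnf"
  assumes cnf: "is_cnf \<phi>"
begin

interpretation primal: sym_graph "\<lambda>u v. (u, v) \<in> parcs (primal_graph \<phi>)"
  using primal_graph_facts(2) by unfold_locales (rule symD)

lemma primal_tree_bags: "\<exists>X \<B>. primal.tree_bags (cnf_tw \<phi> + 1) X \<B> (cnf_vars \<phi>)"
  using treewidth_tree_bags[of "primal_graph \<phi>"] finite_cnf_vars[OF cnf]
  unfolding cnf_tw_def primal_graph_facts(1) by (simp add: primal_graph_facts(2,3))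

lemma clause_clique: "C \<in> \<phi> \<Longrightarrow> primal.clique (clause_vars C)"
  unfolding primal.clique_def by (auto simp: primal_graph_def)

lemma card_clause_vars: "C \<in> \<phi> \<Longrightarrow> card (clause_vars C) \<le> cnf_tw \<phi> + 1"
  using primal_tree_bags primal.tree_bags_clique[OF _ clause_clique clause_vars_subset] by (elim exE)

lemma card_occurrences:
  assumes "x \<in> cnf_vars \<phi>"
  shows "card {C \<in> \<phi>. x \<in> clause_vars C} \<le> cnf_Delta \<phi>"
  unfolding cnf_Delta_def using assms finite_cnf_vars[OF cnf] by (intro Max_ge) auto

lemma cnf_Delta_pos:
  assumes "cnf_vars \<phi> \<noteq> {}"
  shows "1 \<le> cnf_Delta \<phi>"
proof -
  obtain x C where x: "x \<in> clause_vars C" "C \<in> \<phi>" using assms by (auto simp: cnf_vars_def)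
  have "finite {C \<in> \<phi>. x \<in> clause_vars C}" using cnf by (simp add: is_cnf_def)
  then have "1 \<le> card {C \<in> \<phi>. x \<in> clause_vars C}" using x by (simp add: Suc_le_eq card_gt_0_iff) blast
  then show ?thesis using card_occurrences[of x] x clause_vars_subset by fastforce
qed

text \<open>Each clause containing \<open>v\<close> is a clique and so contributes at most
  \<open>cnf_tw \<phi>\<close> further variables.\<close>

lemma card_primal_neighbours:
  assumes "v \<in> cnf_vars \<phi>"
  shows "card {u \<in> cnf_vars \<phi>. (v, u) \<in> parcs (primal_graph \<phi>)} \<le> cnf_Delta \<phi> * cnf_tw \<phi>"
proof -
  let ?O = "{C \<in> \<phi>. v \<in> clause_vars C}"
  have fin: "finite ?O" "\<And>C. C \<in> \<phi> \<Longrightarrow> finite (clause_vars C)"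
    using cnf by (auto simp: is_cnf_def clause_vars_def)
  have "{u \<in> cnf_vars \<phi>. (v, u) \<in> parcs (primal_graph \<phi>)} \<subseteq> (\<Union>C\<in>?O. clause_vars C - {v})"
    by (auto simp: primal_graph_def)
  then have "card {u \<in> cnf_vars \<phi>. (v, u) \<in> parcs (primal_graph \<phi>)} \<le> card (\<Union>C\<in>?O. clause_vars C - {v})"
    using fin by (intro card_mono) auto
  also have "\<dots> \<le> (\<Sum>C\<in>?O. card (clause_vars C - {v}))" by (rule card_UN_le[OF fin(1)])
  also have "\<dots> \<le> (\<Sum>C\<in>?O. cnf_tw \<phi>)"
  proof (rule sum_mono)
    fix C assume "C \<in> ?O"
    then show "card (clause_vars C - {v}) \<le> cnf_tw \<phi>"
      using card_clause_vars[of C] fin(2)[of C] by (simp add: card_Diff_singleton)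
  qed
  also have "\<dots> \<le> cnf_Delta \<phi> * cnf_tw \<phi>" using card_occurrences[OF assms] by simp
  finally show ?thesis .
qed

lemma cnf_two_layouts:
  assumes "1 \<le> cnf_tw \<phi>"
  shows "\<exists>K1 \<H>1 K2 \<H>2. layout (96 * (cnf_Delta \<phi> * cnf_tw \<phi> ^ 2)) \<H>1 K1 \<and>
    layout (96 * (cnf_Delta \<phi> * cnf_tw \<phi> ^ 2)) \<H>2 K2 \<and> set K1 = cnf_vars \<phi> \<and> set K2 = cnf_vars \<phi> \<and>
    (\<forall>C\<in>\<phi>. clause_vars C \<in> \<H>1 \<or> clause_vars C \<in> \<H>2)"
proof -
  let ?k = "cnf_tw \<phi>" and ?d = "cnf_Delta \<phi>"
  have "cnf_vars \<phi> \<noteq> {}"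
    using assms treewidth_no_verts[of "primal_graph \<phi>"] by (force simp: cnf_tw_def primal_graph_def cnf_vars_def)
  then have "1 \<le> ?d * ?k" using cnf_Delta_pos assms by simp
  obtain X \<B> where tb: "primal.tree_bags (?k + 1) X \<B> (cnf_vars \<phi>)" using primal_tree_bags by blast
  obtain K1 \<H>1 K2 \<H>2 where *:
    "layout (48 * (?k + 1) * (?d * ?k)) \<H>1 K1" "layout (48 * (?k + 1) * (?d * ?k)) \<H>2 K2"
    "set K1 = cnf_vars \<phi>" "set K2 = cnf_vars \<phi>"
    "\<forall>Q. Q \<subseteq> cnf_vars \<phi> \<longrightarrow> primal.clique Q \<longrightarrow> Q \<in> \<H>1 \<or> Q \<in> \<H>2"
    using primal.two_layouts_exist[OF tb _ \<open>1 \<le> ?d * ?k\<close> card_primal_neighbours] by auto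
  \<comment> \<open>Positive treewidth gives \<open>?k + 1 \<le> 2 * ?k\<close>, which turns 48 into
    96.\<close>
  have "48 * (?k + 1) * (?d * ?k) \<le> 48 * (2 * ?k) * (?d * ?k)"
    using assms by (intro mult_le_mono) auto
  also have "\<dots> = 96 * (?d * ?k ^ 2)" by (simp add: power2_eq_square)
  finally have le: "48 * (?k + 1) * (?d * ?k) \<le> 96 * (?d * ?k ^ 2)" .
  have "clause_vars C \<in> \<H>1 \<or> clause_vars C \<in> \<H>2" if "C \<in> \<phi>" for C
    using *(5) clause_vars_subset[OF that] clause_clique[OF that] by blast
  then show ?thesis using layout_mono[OF *(1) le] layout_mono[OF *(2) le] *(3,4) by blast
qed

end

lemma represents_wide:
  fixes \<phi> :: "nat cnf"
  assumes cnf: "is_cnf \<phi>" and fal: "falsifiable \<phi>" and tw: "1 \<le> cnf_tw \<phi>"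
  shows "two_obdd_representable \<phi> (2 ^ (98 * (cnf_Delta \<phi> * cnf_tw \<phi> ^ 2)) * card (cnf_vars \<phi>))"
proof -
  let ?m = "cnf_Delta \<phi> * cnf_tw \<phi> ^ 2" and ?n = "card (cnf_vars \<phi>)"
  have ne: "cnf_vars \<phi> \<noteq> {}"
    using tw treewidth_no_verts[of "primal_graph \<phi>"] by (force simp: cnf_tw_def primal_graph_def cnf_vars_def)
  then have n: "1 \<le> ?n" using finite_cnf_vars[OF cnf] by (simp add: Suc_le_eq card_gt_0_iff)
  have m: "1 \<le> ?m" using cnf_Delta_pos[OF cnf ne] tw by simp
  \<comment> \<open>Passing from 96 to 98 gains a factor of 4, as \<open>?m\<close> is at least 1;
    it absorbs the two sinks and the 4 nodes used for a contradiction.\<close>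
  have "(2 :: nat) ^ (96 * ?m + 2) \<le> 2 ^ (98 * ?m)" using m by (intro power_increasing) auto
  then have big: "4 * 2 ^ (96 * ?m) * ?n \<le> 2 ^ (98 * ?m) * ?n" by (intro mult_le_mono1) simp
  have one: "(1 :: nat) \<le> 2 ^ (96 * ?m) * ?n" using n by simp
  show ?thesis
  proof (cases "cnf_models \<phi> = {}")
    case True
    have "4 \<le> 2 ^ (98 * ?m) * ?n" using big one by linarith
    then show ?thesis by (rule two_obdd_representable_mono[OF represents_contradiction[OF True]])
  next
    case False
    obtain K1 \<H>1 K2 \<H>2 where *: "layout (96 * (cnf_Delta \<phi> * cnf_tw \<phi> ^ 2)) \<H>1 K1"
      "layout (96 * (cnf_Delta \<phi> * cnf_tw \<phi> ^ 2)) \<H>2 K2" "set K1 = cnf_vars \<phi>" "set K2 = cnf_vars \<phi>"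
      "\<forall>C\<in>\<phi>. clause_vars C \<in> \<H>1 \<or> clause_vars C \<in> \<H>2"
      using cnf_two_layouts[OF cnf tw] by blast
    have "?n * 2 ^ (96 * ?m) + 2 \<le> 2 ^ (98 * ?m) * ?n"
      using big one mult.commute[of ?n "2 ^ (96 * ?m)"] by linarith
    then show ?thesis
      by (rule two_obdd_representable_mono[OF represents_two_layouts[OF *(1-4) _ False fal], rotated]) (use *(5) in blast)
  qed
qed

lemma represents_narrow:
  fixes \<phi> :: "nat cnf"
  assumes cnf: "is_cnf \<phi>" and fal: "falsifiable \<phi>" and tw: "cnf_tw \<phi> = 0" and n: "5 \<le> card (cnf_vars \<phi>)"
  shows "two_obdd_representable \<phi> (card (cnf_vars \<phi>))"
proof (cases "cnf_models \<phi> = {}")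
  case True
  then show ?thesis using two_obdd_representable_mono[OF represents_contradiction] n by simp
next
  case False
  then show ?thesis
    using represents_unit_clauses[OF cnf _ n False fal] card_clause_vars[OF cnf] tw by simp
qed

theorem theorem4:
  shows "\<exists>\<gamma> :: real. \<forall>\<phi> :: nat cnf.
    is_cnf \<phi> \<and> falsifiable \<phi> \<and> (cnf_tw \<phi> \<ge> 1 \<or> card (cnf_vars \<phi>) \<ge> 5) \<longrightarrow>
    (\<exists>Z1 Z2 :: (nat, nat, nat) obdd.
       is_obdd Z1 \<and> is_obdd Z2 \<and> conjunction_represents Z1 Z2 \<phi> \<and>
       (\<forall>Z\<in>{Z1, Z2}. real (obdd_size Z) \<le>
          2 powr (2 * \<gamma> * real (cnf_Delta \<phi>) * real (cnf_tw \<phi>) ^ 2) * real (card (cnf_vars \<phi>))))"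
proof (intro exI[of _ 49] allI impI, elim conjE)
  fix \<phi> :: "nat cnf"
  assume cnf: "is_cnf \<phi>" and fal: "falsifiable \<phi>" and size: "cnf_tw \<phi> \<ge> 1 \<or> card (cnf_vars \<phi>) \<ge> 5"
  let ?m = "2 ^ (98 * (cnf_Delta \<phi> * cnf_tw \<phi> ^ 2)) * card (cnf_vars \<phi>)"
  \<comment> \<open>The factor 2 of the exponent and the choice 49 for \<gamma> make up the constant
    98.\<close>
  have powr: "2 powr (2 * 49 * real (cnf_Delta \<phi>) * real (cnf_tw \<phi>) ^ 2) * real (card (cnf_vars \<phi>)) = real ?m"
    using powr_realpow[of 2 "98 * (cnf_Delta \<phi> * cnf_tw \<phi> ^ 2)"] by (simp add: mult.assoc)
  have "two_obdd_representable \<phi> ?m"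
  proof (cases "1 \<le> cnf_tw \<phi>")
    case True
    then show ?thesis by (rule represents_wide[OF cnf fal])
  next
    case False
    then have "cnf_tw \<phi> = 0" "5 \<le> card (cnf_vars \<phi>)" using size by simp_all
    then show ?thesis using represents_narrow[OF cnf fal] by simp
  qed
  then show "\<exists>Z1 Z2 :: (nat, nat, nat) obdd. is_obdd Z1 \<and> is_obdd Z2 \<and> conjunction_represents Z1 Z2 \<phi> \<and>
       (\<forall>Z\<in>{Z1, Z2}. real (obdd_size Z) \<le>
          2 powr (2 * 49 * real (cnf_Delta \<phi>) * real (cnf_tw \<phi>) ^ 2) * real (card (cnf_vars \<phi>)))"
    unfolding powr of_nat_le_iff two_obdd_representable_def .
qed

end
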